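(* Let $\beta=(\beta_1,\beta_2,\ldots,\beta_d)\vdash n$ be a partition of $n$ with $d\geq 1$ parts, where $\beta_i\geq 3$ for all $i$. Then $$P_{[2,n-2],\beta}(x)=[y^n]\; x\,y^2(1+y)^{x-2}\,(2x+xy+y)\prod_{i=1}^d\Big\{(1+y)^{\beta_i}-1\Big\}.$$
   Context: $\mathfrak{S}_n$ is the group of permutations of $[n]=\{1,\ldots,n\}$; $\kappa(\pi)$ is the number of disjoint cycles of $\pi\in\mathfrak{S}_n$ (fixed points counted); the cycle-type $\rho(\pi)$ is the partition of $n$ formed by the cycle lengths. $[2,n-2]$ denotes the partition of $n$ with parts $2$ and $n-2$. For a partition $\beta$ of $n$, $\mathcal{C}_\beta$ is the set of permutations in $\mathfrak{S}_n$ of cycle-type $\beta$. Define $$P_{[2,n-2],\beta}(x)=\frac{n(n-1)}{|\mathcal{C}_\beta|}\sum_{\omega\in\mathfrak{S}_n,\ \rho(\omega)=\beta}x^{\kappa(\alpha\omega)},$$ where $\alpha\in\mathfrak{S}_n$ is a fixed permutation of cycle-type $[2,n-2]$ (the polynomial does not depend on the choice of $\alpha$). The notation $[y^n]f(y)$ means the coefficient of $y^n$ in the power series expansion of $f(y)$; here $x$ is an indeterminate and $(1+y)^{x-2}=\sum_{r\ge 0}\binom{x-2}{r}y^r$, where $\binom{x-2}{r}$ is a polynomial in $x$. *)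

theory Defs
  imports
    "HOL-Computational_Algebra.Computational_Algebra"
    "HOL-Combinatorics.Permutations"
    "HOL-Combinatorics.Orbits"
begin

text \<open>Permutations of $[n]$ are functions \<open>\<pi>\<close> with \<open>\<pi> permutes {1..n}\<close>. The disjoint
  cycles of such a \<open>\<pi>\<close> are identified with their supports, the orbits; a fixed point
  \<open>i\<close> contributes the orbit \<open>{i}\<close>.\<close>

definition cycle_sets :: "nat \<Rightarrow> (nat \<Rightarrow> nat) \<Rightarrow> nat set set" where
  "cycle_sets n \<pi> = orbit \<pi> ` {1..n}"

definition num_cycles :: "nat \<Rightarrow> (nat \<Rightarrow> nat) \<Rightarrow> nat" where
  "num_cycles n \<pi> = card (cycle_sets n \<pi>)"

definition cycle_type :: "nat \<Rightarrow> (nat \<Rightarrow> nat) \<Rightarrow> nat multiset" where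
  "cycle_type n \<pi> = image_mset card (mset_set (cycle_sets n \<pi>))"

definition is_partition :: "nat multiset \<Rightarrow> nat \<Rightarrow> bool" where
  "is_partition \<beta> n \<longleftrightarrow> (\<forall>b \<in># \<beta>. b \<ge> 1) \<and> sum_mset \<beta> = n"

definition perms_of_type :: "nat \<Rightarrow> nat multiset \<Rightarrow> (nat \<Rightarrow> nat) set" where
  "perms_of_type n \<beta> = {\<pi>. \<pi> permutes {1..n} \<and> cycle_type n \<pi> = \<beta>}"

abbreviation poly_x :: "rat poly" where
  "poly_x \<equiv> [:0, 1:]"

text \<open>The representative \<open>\<alpha>\<close> of the first cycle type is an explicit argument. Composing
  in the other order gives the same polynomial, since \<open>\<alpha> \<circ> \<omega>\<close> and \<open>\<omega> \<circ> \<alpha>\<close> are conjugate.\<close>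

definition P_poly :: "nat \<Rightarrow> (nat \<Rightarrow> nat) \<Rightarrow> nat multiset \<Rightarrow> rat poly" where
  "P_poly n \<alpha> \<beta> =
     smult (of_nat (n * (n - 1)) / of_nat (card (perms_of_type n \<beta>)))
       (\<Sum>\<omega>\<in>perms_of_type n \<beta>. poly_x ^ num_cycles n (\<alpha> \<circ> \<omega>))"

text \<open>\<open>gchoose\<close> and \<open>fps_binomial\<close> require a field, so the binomial coefficient
  $\binom{p}{r} = p (p-1) \cdots (p-r+1) / r!$ of a polynomial \<open>p\<close>, and the series
  $(1+y)^p = \sum_{r \ge 0} \binom{p}{r} y^r$, are introduced for \<open>rat poly\<close> here.\<close>

definition poly_binomial :: "rat poly \<Rightarrow> nat \<Rightarrow> rat poly" where
  "poly_binomial p r = smult (1 / fact r) (\<Prod>i<r. p - of_nat i)"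

definition binomial_series :: "rat poly \<Rightarrow> rat poly fps" where
  "binomial_series p = Abs_fps (poly_binomial p)"

end

theory Submission
  imports Defs
begin

text \<open>
  Write $u = 1 + y$. If a permutation $c$ fixes the point $b$, then deleting $b$ from the cycles of
  $\sigma$ does not change the number of cycles of $c\sigma$, except that a fixed point $b$ of
  $\sigma$ accounts for one cycle, i.e. a factor $x$.

  Let $c$ be an $n$-cycle. Writing $c = c'\,(a\;b)$ with $c'$ an $(n-1)$-cycle that fixes $b$ and
  deleting $b$ from $(a\;b)\,\omega$ gives a recursion, averaged over all pairs $a \neq b$, for the
  mean of $x^{\kappa(c\omega)}$ over a conjugacy class. Its solution is
  $[y^{n+1}]\,u^x \prod_i (u^{\beta_i} - 1)$. A permutation of type $[2, n-2]$ is $c'\,(a\;b)$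
      with $c'$
  an $(n-2)$-cycle that fixes both $a$ and $b$; deleting both points reduces the theorem to the
      formula
  for long cycles. Multiplication by $(a\;b)$ joins two cycles or cuts one, and deleting two points
  from a cycle with at least three points never exhausts it.

  The resulting sums are evaluated by the following calculus. Let $Q = \prod_i (u^{k_i} - 1)$, let
  $R = \sum_i k_i \prod_{j \neq i} (u^{k_j} - 1)$ and $N = \sum_i k_i$. Then $u Q'
      = N Q + R$, there is
  a similar formula for $u R'$, and what remains is a combination of terms of the form $y F' - m F$,
  whose $m$-th coefficient vanishes.
\<close>

subsection \<open>Generating functions of cuts and joins\<close>

text \<open>The effect of one transposition on a cycle depends on where its two points lie; only the
  sum over all ordered pairs of distinct points is a function of the cycle sizes, namely
  \<open>cut_join\<close>. The factor n(n-1) in \<open>P_poly\<close> is the number of these pairs.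
  The obstacle is a loss of symmetry: once points are singled out for deletion, a class function
  becomes invariant only under conjugators that fix them. The formula for long cycles is therefore
  applied on the points that remain, which also fixes the coefficient to be read off: [y^n] after
  one deletion, [y^(n-1)] after two. The cut and join sums involve squares and pair products of the
  sizes. Part of these cancels between cuts and joins, and the rest occurs only in the combination
  that the derivative of \<open>minor_sum\<close> supplies. The factor 2x + xy + y is what is left
  when all other terms have been collected into y H' - n H for a suitable series H.\<close>

abbreviation u_fps :: "rat poly fps" where "u_fps \<equiv> 1 + fps_X"
abbreviation x_fps :: "rat poly fps" where "x_fps \<equiv> fps_const poly_x"

definition cycle_prod :: "('i \<Rightarrow> nat) \<Rightarrow> 'i set \<Rightarrow> rat poly fps" where
  "cycle_prod k I = (\<Prod>i\<in>I. u_fps ^ k i - 1)"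

text \<open>Weight of a cycle with \<open>k\<close> points left after deletions. A cycle that is deleted completely
  still counts as a cycle of the product with \<open>c\<close>, which explains the value at \<open>0\<close>.\<close>
definition cycle_wt :: "nat \<Rightarrow> rat poly fps" where
  "cycle_wt k = (if k = 0 then x_fps else u_fps ^ k - 1)"

definition minor_sum :: "('i \<Rightarrow> nat) \<Rightarrow> 'i set \<Rightarrow> rat poly fps" where
  "minor_sum k I = (\<Sum>i\<in>I. of_nat (k i) * cycle_prod k (I - {i}))"

text \<open>Writing \<open>u_fps ^ k i\<close> as its factor plus 1 restores the missing factor.
  This is how powers with a cycle size as exponent are eliminated below.\<close>

lemma cycle_prod_remove:
  assumes "finite I" "i \<in> I"
  shows "u_fps ^ k i * cycle_prod k (I - {i}) = cycle_prod k I + cycle_prod k (I - {i})"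
  unfolding cycle_prod_def using prod.remove[OF assms, of "\<lambda>i. u_fps ^ k i - 1"]
  by (simp add: algebra_simps)

lemma u_power_deriv: "u_fps * fps_deriv (u_fps ^ k) = of_nat k * u_fps ^ k"
  by (induction k) (simp_all add: algebra_simps)

lemma cycle_prod_insert:
  "finite I \<Longrightarrow> i \<notin> I \<Longrightarrow> cycle_prod k (insert i I) = (u_fps ^ k i - 1) * cycle_prod k I"
  by (simp add: cycle_prod_def)

text \<open>Each factor q = u^k - 1 satisfies u q' = k (q + 1). In the product rule the terms k q
  add up to N times the product, while the lone k, each with its factor missing, form
  \<open>minor_sum\<close>.\<close>

lemma cycle_prod_deriv:
  assumes "finite I"
  shows "u_fps * fps_deriv (cycle_prod k I) = of_nat (sum k I) * cycle_prod k I + minor_sum k I"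
  using assms
proof (induction I rule: finite_induct)
  case empty
  then show ?case by (simp add: cycle_prod_def minor_sum_def)
next
  case (insert i I)
  define q where "q = u_fps ^ k i - 1"
  define P where "P = cycle_prod k I"
  define R where "R = minor_sum k I"
  have 1: "cycle_prod k (insert i I) = q * P"
    using insert by (simp add: cycle_prod_insert q_def P_def)
  have 2: "minor_sum k (insert i I) = of_nat (k i) * P + q * R"
  proof -
    have "(\<Sum>j\<in>I. of_nat (k j) * cycle_prod k (insert i I - {j}))
        = (\<Sum>j\<in>I. q * (of_nat (k j) * cycle_prod k (I - {j})))"
    proof (rule sum.cong[OF refl])
      fix j assume "j \<in> I"
      then have "insert i I - {j} = insert i (I - {j})" using insert by auto
      then show "of_nat (k j) * cycle_prod k (insert i I - {j})
          = q * (of_nat (k j) * cycle_prod k (I - {j}))"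
        using insert by (simp add: cycle_prod_insert q_def algebra_simps)
    qed
    then show ?thesis using insert by (simp add: minor_sum_def P_def R_def sum_distrib_left)
  qed
  have 3: "u_fps * fps_deriv q = of_nat (k i) * (q + 1)"
    using u_power_deriv[of "k i"] by (simp add: q_def)
  have "u_fps * fps_deriv (q * P) = q * (u_fps * fps_deriv P) + (u_fps * fps_deriv q) * P"
    by (simp add: algebra_simps)
  also have "\<dots> = q * (of_nat (sum k I) * P + R) + of_nat (k i) * (q + 1) * P"
    using insert.IH unfolding P_def R_def 3[unfolded P_def R_def] by simp
  finally show ?case using insert.hyps unfolding 1 2 by (simp add: algebra_simps)
qed

text \<open>Each term is differentiated by \<open>cycle_prod_deriv\<close> with total size N - k i,
  and the correction - k i produces the squares. The last two sums survive later only in this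
  combination, so the derivative can replace both.\<close>

lemma minor_sum_deriv:
  assumes "finite I"
  shows "u_fps * fps_deriv (minor_sum k I) = of_nat (sum k I) * minor_sum k I
     - (\<Sum>i\<in>I. of_nat (k i)^2 * cycle_prod k (I - {i}))
     + (\<Sum>i\<in>I. \<Sum>j\<in>I-{i}. of_nat (k i) * of_nat (k j) * cycle_prod k (I - {i} - {j}))"
proof -
  have "u_fps * fps_deriv (minor_sum k I)
      = (\<Sum>i\<in>I. of_nat (k i) * (u_fps * fps_deriv (cycle_prod k (I - {i}))))"
    by (simp add: minor_sum_def fps_deriv_sum sum_distrib_left algebra_simps)
  also have "\<dots> = (\<Sum>i\<in>I. of_nat (sum k I) * (of_nat (k i) * cycle_prod k (I - {i}))
      - of_nat (k i)^2 * cycle_prod k (I - {i})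
      + (\<Sum>j\<in>I-{i}. of_nat (k i) * of_nat (k j) * cycle_prod k (I - {i} - {j})))"
  proof (rule sum.cong[OF refl])
    fix i assume "i \<in> I"
    then have "sum k I = k i + sum k (I - {i})" using assms by (simp add: sum.remove)
    then have N: "of_nat (sum k I) = (of_nat (k i) + of_nat (sum k (I - {i})) :: rat poly fps)"
      by (simp only: of_nat_add)
    have R: "(\<Sum>j\<in>I-{i}. of_nat (k i) * of_nat (k j) * cycle_prod k (I - {i} - {j}))
      = of_nat (k i) * minor_sum k (I - {i})"
      by (simp add: minor_sum_def sum_distrib_left mult.assoc)
    have D: "u_fps * fps_deriv (cycle_prod k (I - {i})) =
        of_nat (sum k (I - {i})) * cycle_prod k (I - {i}) + minor_sum k (I - {i})"
      using assms by (intro cycle_prod_deriv) auto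
    show "of_nat (k i) * (u_fps * fps_deriv (cycle_prod k (I - {i})))
        = of_nat (sum k I) * (of_nat (k i) * cycle_prod k (I - {i}))
      - of_nat (k i)^2 * cycle_prod k (I - {i})
      + (\<Sum>j\<in>I-{i}. of_nat (k i) * of_nat (k j) * cycle_prod k (I - {i} - {j}))"
      unfolding N R D by (simp only: power2_eq_square)
          (simp add: distrib_left distrib_right mult.assoc)
  qed
  finally show ?thesis
    by (simp add: sum.distrib sum_subtractf sum_distrib_left minor_sum_def)
qed

section \<open>Closed forms of the join and cut sums\<close>

lemma sum_off_diagonal:
  fixes a :: "'i \<Rightarrow> 'r :: comm_ring_1"
  assumes "finite I"
  shows "(\<Sum>i\<in>I. \<Sum>j\<in>I-{i}. a i * b j) = sum a I * sum b I - (\<Sum>i\<in>I. a i * b i)"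
proof -
  have "(\<Sum>j\<in>I-{i}. a i * b j) = a i * sum b I - a i * b i" if "i \<in> I" for i
    using sum.remove[OF assms that, of b] by (simp add: sum_distrib_left[symmetric] algebra_simps)
  then show ?thesis by (simp add: sum_subtractf sum_distrib_right)
qed

text \<open>The factor \<open>u_fps ^ s\<close> clears the exponent \<open>k i + k j - s\<close>,
  and u^(k i + k j) times the product without i and j is the sum of the four products with or
  without each of these factors. The second hypothesis keeps the joined cycle nonempty after
  deletion, so \<open>cycle_wt\<close> is in its power case.\<close>

lemma join_sum:
  assumes "finite I" and "\<And>i j. i \<in> I \<Longrightarrow> j \<in> I \<Longrightarrow> s < k i + k j"
  shows "u_fps ^ s * (\<Sum>i\<in>I. \<Sum>j\<in>I-{i}. of_nat (k i) * of_nat (k j) * cycle_wt (k i + k j - s)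
      * cycle_prod k (I - {i} - {j}))
    = (of_nat (sum k I)^2 - (\<Sum>i\<in>I. of_nat (k i)^2)) * cycle_prod k I
     + 2 * of_nat (sum k I) * minor_sum k I - 2 * (\<Sum>i\<in>I. of_nat (k i)^2 * cycle_prod k (I - {i}))
     + (1 - u_fps ^ s) * (\<Sum>i\<in>I. \<Sum>j\<in>I-{i}. of_nat (k i) * of_nat (k j)
         * cycle_prod k (I - {i} - {j}))"
    (is "?L = ?R")
proof -
  let ?P = "cycle_prod k I" let ?Pi = "\<lambda>i. cycle_prod k (I - {i})"
  let ?Pij = "\<lambda>i j. cycle_prod k (I - {i} - {j})"
  have *: "u_fps ^ s * (of_nat (k i) * of_nat (k j) * cycle_wt (k i + k j - s) * ?Pij i j)
     = of_nat (k i) * (of_nat (k j) * ?P) + of_nat (k i) * (of_nat (k j) * ?Pi j)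
         + (of_nat (k i) * ?Pi i) * of_nat (k j)
      + (1 - u_fps ^ s) * (of_nat (k i) * of_nat (k j) * ?Pij i j)"
    if "i \<in> I" "j \<in> I - {i}" for i j
  proof -
    have 1: "u_fps ^ k j * ?Pij i j = ?Pi i + ?Pij i j"
      using assms that by (intro cycle_prod_remove) auto
    have 2: "u_fps ^ k i * ?Pi i = ?P + ?Pi i"
      using assms that by (intro cycle_prod_remove) auto
    have 3: "u_fps ^ k i * ?Pij i j = ?Pi j + ?Pij i j"
      using cycle_prod_remove[of "I - {j}" i k] assms that
      by (auto simp: Diff_insert2[symmetric] insert_commute)
    have 4: "u_fps ^ s * cycle_wt (k i + k j - s) = u_fps ^ k i * u_fps ^ k j - u_fps ^ s"
      using assms(2)[of i j] that by (simp add: cycle_wt_def algebra_simps flip: power_add)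
    have "u_fps ^ s * (of_nat (k i) * of_nat (k j) * cycle_wt (k i + k j - s) * ?Pij i j)
        = of_nat (k i) * of_nat (k j) * ((u_fps ^ s * cycle_wt (k i + k j - s)) * ?Pij i j)"
      by (simp add: mult_ac)
    also have "(u_fps ^ s * cycle_wt (k i + k j - s)) * ?Pij i j
        = u_fps ^ k i * (u_fps ^ k j * ?Pij i j) - u_fps ^ s * ?Pij i j"
      unfolding 4 by (simp only: left_diff_distrib mult.assoc)
    also have "\<dots> = ?P + ?Pi i + ?Pi j + ?Pij i j - u_fps ^ s * ?Pij i j"
      unfolding 1 distrib_left 2 3 by simp
    finally show ?thesis by (simp add: algebra_simps)
  qed
  have "?L = (\<Sum>i\<in>I. \<Sum>j\<in>I-{i}. of_nat (k i) * (of_nat (k j) * ?P)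
      + of_nat (k i) * (of_nat (k j) * ?Pi j) + (of_nat (k i) * ?Pi i) * of_nat (k j)
      + (1 - u_fps ^ s) * (of_nat (k i) * of_nat (k j) * ?Pij i j))"
    unfolding sum_distrib_left by (intro sum.cong refl *)
  also have "\<dots> = (\<Sum>i\<in>I. \<Sum>j\<in>I-{i}. of_nat (k i) * (of_nat (k j) * ?P))
      + (\<Sum>i\<in>I. \<Sum>j\<in>I-{i}. of_nat (k i) * (of_nat (k j) * ?Pi j))
      + (\<Sum>i\<in>I. \<Sum>j\<in>I-{i}. of_nat (k i) * ?Pi i * of_nat (k j))
      + (1 - u_fps ^ s) * (\<Sum>i\<in>I. \<Sum>j\<in>I-{i}. of_nat (k i) * of_nat (k j) * ?Pij i j)"
    by (simp only: sum.distrib sum_distrib_left)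
  also have "(\<Sum>i\<in>I. \<Sum>j\<in>I-{i}. of_nat (k i) * (of_nat (k j) * ?P))
      = (of_nat (sum k I)^2 - (\<Sum>i\<in>I. of_nat (k i)^2)) * ?P"
    by (simp add: sum_off_diagonal[OF assms(1)] left_diff_distrib power2_eq_square
        sum_distrib_right mult.assoc)
  also have "(\<Sum>i\<in>I. \<Sum>j\<in>I-{i}. of_nat (k i) * (of_nat (k j) * ?Pi j))
      = of_nat (sum k I) * minor_sum k I - (\<Sum>i\<in>I. of_nat (k i)^2 * ?Pi i)"
    by (simp add: sum_off_diagonal[OF assms(1)] minor_sum_def power2_eq_square mult.assoc)
  also have "(\<Sum>i\<in>I. \<Sum>j\<in>I-{i}. of_nat (k i) * ?Pi i * of_nat (k j))
      = of_nat (sum k I) * minor_sum k I - (\<Sum>i\<in>I. of_nat (k i)^2 * ?Pi i)"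
    unfolding sum_off_diagonal[OF assms(1)] by (simp add: minor_sum_def power2_eq_square mult_ac)
  finally show ?thesis by simp
qed

text \<open>The term e = 0 stands for a completely deleted piece and contributes x. The others
  expand into geometric series in \<open>u_fps\<close>, which the factor y = u - 1 sums.\<close>

lemma cut_sum:
  "fps_X * (\<Sum>e<m. cycle_wt e * cycle_wt (m - e))
    = fps_X * ((of_nat m - 1) * (u_fps ^ m + 1) + x_fps * (u_fps ^ m - 1))
        - 2 * (u_fps ^ m - u_fps)"
proof (cases m)
  case (Suc l)
  have "(\<Sum>e<m. cycle_wt e * cycle_wt (m - e))
      = x_fps * (u_fps ^ m - 1) + (\<Sum>e<l. (u_fps ^ Suc e - 1) * (u_fps ^ (l - e) - 1))"
    unfolding Suc sum.lessThan_Suc_shift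
    by (intro arg_cong2[where f="(+)"] sum.cong) (auto simp: cycle_wt_def)
  also have "(\<Sum>e<l. (u_fps ^ Suc e - 1) * (u_fps ^ (l - e) - 1))
      = (\<Sum>e<l. (u_fps ^ m + 1) - u_fps ^ Suc e - u_fps ^ Suc (l - Suc e))"
  proof (intro sum.cong refl)
    fix e assume "e \<in> {..<l}"
    then have "u_fps ^ m = u_fps ^ Suc e * u_fps ^ (l - e)" "Suc (l - Suc e) = l - e"
      by (simp_all add: Suc flip: power_add power_Suc)
    then show "(u_fps ^ Suc e - 1) * (u_fps ^ (l - e) - 1)
        = (u_fps ^ m + 1) - u_fps ^ Suc e - u_fps ^ Suc (l - Suc e)"
      by (simp add: left_diff_distrib right_diff_distrib)
  qed
  also have "\<dots> = of_nat l * (u_fps ^ m + 1) - 2 * (\<Sum>e<l. u_fps ^ Suc e)"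
    unfolding sum_subtractf sum.nat_diff_reindex[of "\<lambda>e. u_fps ^ Suc e"] by simp
  also have "(\<Sum>e<l. u_fps ^ Suc e) = u_fps * (\<Sum>e<l. u_fps ^ e)" by (simp add: sum_distrib_left)
  finally have A: "(\<Sum>e<m. cycle_wt e * cycle_wt (m - e))
      = x_fps * (u_fps ^ m - 1) + (of_nat l * (u_fps ^ m + 1) - 2 * (u_fps * (\<Sum>e<l. u_fps ^ e)))" .
  have "fps_X * (\<Sum>e<l. u_fps ^ e) = u_fps ^ l - 1"
    using power_diff_1_eq[of u_fps l] by simp
  then have "fps_X * (u_fps * (\<Sum>e<l. u_fps ^ e)) = u_fps ^ m - u_fps"
    unfolding Suc power_Suc mult.left_commute[of fps_X u_fps]
        by (simp only: right_diff_distrib mult_1_right)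
  then have B: "fps_X * (2 * (u_fps * (\<Sum>e<l. u_fps ^ e))) = 2 * (u_fps ^ m - u_fps)"
    by (simp only: mult.left_commute[of fps_X 2])
  have C: "of_nat m - 1 = (of_nat l :: rat poly fps)" by (simp add: Suc)
  show ?thesis unfolding A C distrib_left right_diff_distrib[of fps_X] B
      by (simp add: algebra_simps)
qed (simp add: algebra_simps)

text \<open>Total weight of the permutations \<open>transpose a b \<circ> \<omega>\<close>, \<open>a \<noteq> b\<close>, with \<open>s\<close> of the points
  \<open>a\<close>, \<open>b\<close> deleted, where \<open>\<omega>\<close> has cycles of sizes \<open>k i\<close>. The two sums collect the pairs in
  different cycles, which are joined, and those in one cycle, which is cut.\<close>
definition cut_join :: "nat \<Rightarrow> ('i \<Rightarrow> nat) \<Rightarrow> 'i set \<Rightarrow> rat poly fps" where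
  "cut_join s k I =
     (\<Sum>i\<in>I. \<Sum>j\<in>I-{i}. of_nat (k i) * of_nat (k j) * cycle_wt (k i + k j - s)
         * cycle_prod k (I - {i} - {j}))
   + (\<Sum>i\<in>I. of_nat (k i) * (\<Sum>e<k i - 1. cycle_wt e * cycle_wt (k i - s - e))
       * cycle_prod k (I - {i}))"

lemma u_fps_nonzero: "u_fps \<noteq> 0"
  by (auto simp: fps_eq_iff intro!: exI[of _ 0])

text \<open>After multiplication by u the sums S of squares cancel between joins and cuts, and S2
  and R2 meet as (1 - u)(R2 - S2), which \<open>minor_sum_deriv\<close> turns into a derivative. The
  factor u is cancelled at the end.\<close>

lemma cut_join_1:
  assumes "finite I" and pos: "\<And>i. i \<in> I \<Longrightarrow> k i > 0"
  shows "fps_X * cut_join 1 k I = (of_nat (sum k I) + x_fps) * fps_X * fps_deriv (cycle_prod k I)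
     - fps_X^2 * fps_deriv (minor_sum k I) + (of_nat (sum k I) - x_fps) * fps_X * minor_sum k I
     - 2 * of_nat (sum k I) * cycle_prod k I"
proof -
  let ?Pi = "\<lambda>i. cycle_prod k (I - {i})"
  let ?c = "\<lambda>i. of_nat (k i) :: rat poly fps"
  define P where "P = cycle_prod k I"
  define R where "R = minor_sum k I"
  define N :: "rat poly fps" where "N = of_nat (sum k I)"
  define S where "S = (\<Sum>i\<in>I. ?c i ^ 2)"
  define S2 where "S2 = (\<Sum>i\<in>I. ?c i ^ 2 * ?Pi i)"
  define R2 where "R2 = (\<Sum>i\<in>I. \<Sum>j\<in>I-{i}. ?c i * ?c j * cycle_prod k (I - {i} - {j}))"
  define A where "A i = (\<Sum>e<k i - 1. cycle_wt e * cycle_wt (k i - 1 - e))" for i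
  have cut: "u_fps * fps_X * (?c i * A i * ?Pi i)
     = fps_X * (?c i ^ 2 * P) + fps_X * (1 + u_fps) * (?c i ^ 2 * ?Pi i)
       + (x_fps * fps_X - 2 * fps_X - 2) * (?c i * P)
       + (- 2 * fps_X * (1 + u_fps) + x_fps * fps_X * (1 - u_fps) - 2 * (1 - u_fps ^ 2))
           * (?c i * ?Pi i)"
    if i: "i \<in> I" for i
  proof -
    have 1: "u_fps ^ k i * ?Pi i = P + ?Pi i"
      unfolding P_def using assms i by (intro cycle_prod_remove) auto
    have 2: "u_fps * u_fps ^ (k i - 1) = u_fps ^ k i"
      using pos[OF i] by (simp add: power_eq_if)
    \<comment> \<open>\<open>cut_sum\<close> is used with m = k i - 1, so its factor m - 1 becomes
      \<open>?c i - 2\<close>.\<close>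
    have 3: "of_nat (k i - 1) = ?c i - 1" using pos[OF i] by simp
    have "u_fps * fps_X * (?c i * A i * ?Pi i)
      = u_fps * ?c i * (fps_X * A i) * ?Pi i"
      by (simp only: mult_ac)
    also have "\<dots> = ?c i * (fps_X * ((?c i - 2) * (u_fps * u_fps ^ (k i - 1) + u_fps)
        + x_fps * (u_fps * u_fps ^ (k i - 1) - u_fps))
        - 2 * (u_fps * u_fps ^ (k i - 1) - u_fps ^ 2)) * ?Pi i"
      unfolding A_def cut_sum 3 by algebra
    also have "\<dots> = ?c i * (fps_X * ((?c i - 2) * (u_fps ^ k i * ?Pi i + u_fps * ?Pi i)
        + x_fps * (u_fps ^ k i * ?Pi i - u_fps * ?Pi i))
        - 2 * (u_fps ^ k i * ?Pi i - u_fps ^ 2 * ?Pi i))"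
      unfolding 2 by algebra
    finally show ?thesis unfolding 1 by algebra
  qed
  have cuts: "u_fps * fps_X * (\<Sum>i\<in>I. ?c i * A i * ?Pi i)
     = fps_X * (S * P) + fps_X * (1 + u_fps) * S2
       + (x_fps * fps_X - 2 * fps_X - 2) * (N * P)
       + (- 2 * fps_X * (1 + u_fps) + x_fps * fps_X * (1 - u_fps) - 2 * (1 - u_fps ^ 2)) * R"
    unfolding S_def S2_def N_def R_def minor_sum_def of_nat_sum sum_distrib_right
    unfolding sum_distrib_left sum.distrib[symmetric]
    by (intro sum.cong refl cut)
  have "1 < k i + k j" if "i \<in> I" "j \<in> I" for i j
    using pos[OF that(1)] pos[OF that(2)] by simp
  from join_sum[OF assms(1) this]
  have joins: "u_fps * (\<Sum>i\<in>I. \<Sum>j\<in>I-{i}. ?c i * ?c j * cycle_wt (k i + k j - 1)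
      * cycle_prod k (I - {i} - {j}))
    = (N^2 - S) * P + 2 * N * R - 2 * S2 + (1 - u_fps) * R2"
    by (simp only: power_one_right N_def S_def P_def R_def S2_def R2_def)
  have P': "u_fps * fps_deriv P = N * P + R" using cycle_prod_deriv[OF assms(1)]
      unfolding P_def N_def R_def .
  have R': "u_fps * fps_deriv R = N * R - S2 + R2" using minor_sum_deriv[OF assms(1)]
      unfolding S2_def N_def R_def R2_def .
  have "u_fps * (fps_X * cut_join 1 k I) = fps_X
      * ((N^2 - S) * P + 2 * N * R - 2 * S2 + (1 - u_fps) * R2)
      + (fps_X * (S * P) + fps_X * (1 + u_fps) * S2
       + (x_fps * fps_X - 2 * fps_X - 2) * (N * P)
       + (- 2 * fps_X * (1 + u_fps) + x_fps * fps_X * (1 - u_fps) - 2 * (1 - u_fps ^ 2)) * R)"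
    unfolding joins[symmetric] cuts[symmetric] cut_join_def A_def by algebra
  also have "\<dots> = u_fps * ((N + x_fps) * fps_X * fps_deriv P - fps_X^2 * fps_deriv R
      + (N - x_fps) * fps_X * R - 2 * N * P)"
    using P' R' by algebra
  finally show ?thesis
    using u_fps_nonzero unfolding P_def N_def R_def by simp
qed

text \<open>The same elimination with s = 2, where S2 and R2 meet as (1 - u^2)(R2 - S2). The factor
  \<open>u_fps ^ 2\<close> is kept because (1+y)^x = u^2 (1+y)^(x-2) provides it later.\<close>

lemma cut_join_2:
  assumes "finite I" and pos: "\<And>i. i \<in> I \<Longrightarrow> k i \<ge> 3"
  shows "u_fps ^ 2 * fps_X * cut_join 2 k I =
     fps_X * (of_nat (sum k I)^2 * cycle_prod k I + 2 * of_nat (sum k I) * minor_sum k I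
       + (1 - u_fps ^ 2) * (u_fps * fps_deriv (minor_sum k I) - of_nat (sum k I) * minor_sum k I)
       - 3 * of_nat (sum k I) * cycle_prod k I + 2 * x_fps * of_nat (sum k I) * cycle_prod k I)
     + (- 3 * fps_X * (1 + u_fps ^ 2) + 2 * x_fps * fps_X * (1 - u_fps ^ 2) - 2 * (1 - u_fps ^ 3))
         * minor_sum k I
     - 2 * of_nat (sum k I) * cycle_prod k I"
proof -
  let ?Pi = "\<lambda>i. cycle_prod k (I - {i})"
  let ?c = "\<lambda>i. of_nat (k i) :: rat poly fps"
  define P where "P = cycle_prod k I"
  define R where "R = minor_sum k I"
  define N :: "rat poly fps" where "N = of_nat (sum k I)"
  define S where "S = (\<Sum>i\<in>I. ?c i ^ 2)"
  define S2 where "S2 = (\<Sum>i\<in>I. ?c i ^ 2 * ?Pi i)"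
  define R2 where "R2 = (\<Sum>i\<in>I. \<Sum>j\<in>I-{i}. ?c i * ?c j * cycle_prod k (I - {i} - {j}))"
  define A where "A i = (\<Sum>e<k i - 1. cycle_wt e * cycle_wt (k i - 2 - e))" for i
  have cut: "u_fps ^ 2 * fps_X * (?c i * A i * ?Pi i)
     = fps_X * (?c i ^ 2 * P) + fps_X * (1 + u_fps ^ 2) * (?c i ^ 2 * ?Pi i)
       + (2 * x_fps * fps_X - 3 * fps_X - 2) * (?c i * P)
       + (- 3 * fps_X * (1 + u_fps ^ 2) + 2 * x_fps * fps_X * (1 - u_fps ^ 2)
           - 2 * (1 - u_fps ^ 3)) * (?c i * ?Pi i)"
    if i: "i \<in> I" for i
  proof -
    define m where "m = k i - 2"
    have m: "k i = m + 2" "m > 0" using pos[OF i] by (simp_all add: m_def)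
    have 1: "u_fps ^ k i * ?Pi i = P + ?Pi i"
      unfolding P_def using assms i by (intro cycle_prod_remove) auto
    have 2: "u_fps ^ 2 * u_fps ^ m = u_fps ^ k i" by (simp only: m(1) power_add mult_ac)
    have 3: "of_nat m = ?c i - 2" by (simp add: m)
    have km: "k i - 1 = Suc m" "k i - 2 = m" by (simp_all add: m)
    \<comment> \<open>With both points deleted e may reach m = k i - 2, where the other piece
      vanishes. This adds one term to \<open>cut_sum\<close> and doubles the coefficient of x. Since
      m > 0, the two pieces never vanish together.\<close>
    have "fps_X * (\<Sum>e<k i - 1. cycle_wt e * cycle_wt (k i - 2 - e))
      = fps_X * (\<Sum>e<m. cycle_wt e * cycle_wt (m - e)) + fps_X * x_fps * (u_fps ^ m - 1)"
      unfolding km using m(2) by (simp add: cycle_wt_def algebra_simps)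
    also have "\<dots> = fps_X * ((?c i - 3) * (u_fps ^ m + 1) + 2 * x_fps * (u_fps ^ m - 1))
        - 2 * (u_fps ^ m - u_fps)"
      unfolding cut_sum 3 by algebra
    finally have 4: "fps_X * (\<Sum>e<k i - 1. cycle_wt e * cycle_wt (k i - 2 - e)) = \<dots>" .
    have "u_fps ^ 2 * fps_X * (?c i * A i * ?Pi i)
      = u_fps ^ 2 * ?c i * (fps_X * A i) * ?Pi i"
      by (simp only: mult_ac)
    also have "\<dots> = ?c i * (fps_X * ((?c i - 3) * (u_fps ^ 2 * u_fps ^ m + u_fps ^ 2)
        + 2 * x_fps * (u_fps ^ 2 * u_fps ^ m - u_fps ^ 2))
        - 2 * (u_fps ^ 2 * u_fps ^ m - u_fps ^ 3)) * ?Pi i"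
      unfolding A_def 4 by algebra
    also have "\<dots> = ?c i * (fps_X * ((?c i - 3) * (u_fps ^ k i * ?Pi i + u_fps ^ 2 * ?Pi i)
        + 2 * x_fps * (u_fps ^ k i * ?Pi i - u_fps ^ 2 * ?Pi i))
        - 2 * (u_fps ^ k i * ?Pi i - u_fps ^ 3 * ?Pi i))"
      unfolding 2 by algebra
    finally show ?thesis unfolding 1 by algebra
  qed
  have cuts: "u_fps ^ 2 * fps_X * (\<Sum>i\<in>I. ?c i * A i * ?Pi i)
     = fps_X * (S * P) + fps_X * (1 + u_fps ^ 2) * S2
       + (2 * x_fps * fps_X - 3 * fps_X - 2) * (N * P)
       + (- 3 * fps_X * (1 + u_fps ^ 2) + 2 * x_fps * fps_X * (1 - u_fps ^ 2)
           - 2 * (1 - u_fps ^ 3)) * R"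
    unfolding S_def S2_def N_def R_def minor_sum_def of_nat_sum sum_distrib_right
    unfolding sum_distrib_left sum.distrib[symmetric]
    by (intro sum.cong refl cut)
  have "2 < k i + k j" if "i \<in> I" "j \<in> I" for i j
    using pos[OF that(1)] pos[OF that(2)] by simp
  from join_sum[OF assms(1) this]
  have joins: "u_fps ^ 2 * (\<Sum>i\<in>I. \<Sum>j\<in>I-{i}. ?c i * ?c j * cycle_wt (k i + k j - 2)
      * cycle_prod k (I - {i} - {j}))
    = (N^2 - S) * P + 2 * N * R - 2 * S2 + (1 - u_fps ^ 2) * R2"
    by (simp only: N_def S_def P_def R_def S2_def R2_def)
  have R': "u_fps * fps_deriv R = N * R - S2 + R2" using minor_sum_deriv[OF assms(1)]
      unfolding S2_def N_def R_def R2_def .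
  have "u_fps ^ 2 * fps_X * cut_join 2 k I
      = fps_X * ((N^2 - S) * P + 2 * N * R - 2 * S2 + (1 - u_fps ^ 2) * R2)
      + (fps_X * (S * P) + fps_X * (1 + u_fps ^ 2) * S2
       + (2 * x_fps * fps_X - 3 * fps_X - 2) * (N * P)
       + (- 3 * fps_X * (1 + u_fps ^ 2) + 2 * x_fps * fps_X * (1 - u_fps ^ 2)
           - 2 * (1 - u_fps ^ 3)) * R)"
    unfolding joins[symmetric] cuts[symmetric] cut_join_def A_def by algebra
  then show ?thesis
    using R' unfolding P_def[symmetric] N_def[symmetric] R_def[symmetric] by algebra
qed

section \<open>The binomial series with a polynomial exponent\<close>

lemma poly_binomial_Suc:
  "of_nat (Suc r) * poly_binomial p (Suc r) = (p - of_nat r) * poly_binomial p r"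
proof -
  have "of_nat (Suc r) * poly_binomial p (Suc r)
      = smult (of_nat (Suc r) * (1 / fact (Suc r))) ((\<Prod>i<r. p - of_nat i) * (p - of_nat r))"
    by (simp add: poly_binomial_def of_nat_poly)
  also have "of_nat (Suc r) * (1 / fact (Suc r)) = (1 / fact r :: rat)"
    by (simp add: field_simps del: of_nat_Suc)
  finally show ?thesis by (simp add: poly_binomial_def mult.commute)
qed

text \<open>The differential equation of (1+y)^p, which is \<open>poly_binomial_Suc\<close> read
  coefficientwise.\<close>

lemma binomial_series_deriv:
  "u_fps * fps_deriv (binomial_series p) = fps_const p * binomial_series p"
proof (rule fps_ext)
  fix r
  show "(u_fps * fps_deriv (binomial_series p)) $ r = (fps_const p * binomial_series p) $ r"
  proof (cases r)
    case 0
    then show ?thesis using poly_binomial_Suc[of 0 p]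
        by (simp add: binomial_series_def distrib_right)
  next
    case (Suc l)
    then have "(u_fps * fps_deriv (binomial_series p)) $ r
        = of_nat (Suc r) * poly_binomial p (Suc r) + of_nat r * poly_binomial p r"
      by (simp add: binomial_series_def distrib_right)
    then show ?thesis unfolding poly_binomial_Suc by (simp add: binomial_series_def algebra_simps)
  qed
qed

text \<open>Pascal's rule for a polynomial upper argument, proved after multiplication by
  \<open>Suc l\<close>, where the factor p + 1 can be pulled out of the product.\<close>

lemma binomial_series_add_1:
  "binomial_series (p + 1) = u_fps * binomial_series p"
proof (rule fps_ext)
  fix r
  show "binomial_series (p + 1) $ r = (u_fps * binomial_series p) $ r"
  proof (cases r)
    case 0
    then show ?thesis by (simp add: binomial_series_def poly_binomial_def distrib_right)
  next
    case (Suc l)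
    have "(\<Prod>i<Suc l. p + 1 - of_nat i) = (p + 1) * (\<Prod>i<l. p - of_nat i)"
      unfolding prod.lessThan_Suc_shift by simp
    then have "of_nat (Suc l) * poly_binomial (p + 1) (Suc l)
        = smult (of_nat (Suc l) * (1 / fact (Suc l))) ((p + 1) * (\<Prod>i<l. p - of_nat i))"
      unfolding poly_binomial_def by (simp add: of_nat_poly)
    also have "of_nat (Suc l) * (1 / fact (Suc l)) = (1 / fact l :: rat)"
      by (simp add: field_simps del: of_nat_Suc)
    also have "smult (1 / fact l) ((p + 1) * (\<Prod>i<l. p - of_nat i)) = (p + 1) * poly_binomial p l"
      by (simp add: poly_binomial_def)
    also have "\<dots> = of_nat (Suc l) * (poly_binomial p (Suc l) + poly_binomial p l)"
      using poly_binomial_Suc[of l p] by (simp add: algebra_simps)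
    finally have "poly_binomial (p + 1) (Suc l) = poly_binomial p (Suc l) + poly_binomial p l"
      by (metis mult_cancel_left of_nat_eq_0_iff nat.distinct(2))
    then show ?thesis using Suc by (simp add: binomial_series_def distrib_right)
  qed
qed

section \<open>Coefficient extraction\<close>

lemma X_deriv_nth: "(fps_X * fps_deriv F) $ r = of_nat r * (F $ r :: rat poly)"
  by (cases r) simp_all

lemma of_nat_mult_nth: "(of_nat m * F) $ r = of_nat m * (F $ r :: rat poly)"
  by (metis fps_mult_left_const_nth fps_of_nat)

text \<open>All terms are expressed through F = Z * P and G = Z * R. At index n + 1 the G part,
  shifted by one, vanishes, and the F part leaves the factor n (n + 1) - 2 n = n (n - 1).\<close>

lemma cut_join_1_coeff:
  assumes "finite I" and pos: "\<And>i. i \<in> I \<Longrightarrow> k i > 0"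
  defines "Z \<equiv> binomial_series poly_x"
  shows "(Z * cut_join 1 k I) $ sum k I
    = of_nat (sum k I) * (of_nat (sum k I) - 1) * (Z * cycle_prod k I) $ (sum k I + 1)"
proof -
  define P where "P = cycle_prod k I"
  define R where "R = minor_sum k I"
  define n where "n = sum k I"
  define N :: "rat poly fps" where "N = of_nat n"
  define V where "V = binomial_series (poly_x - 1)"
  have Z: "Z = u_fps * V"
    using binomial_series_add_1[of "poly_x - 1"] by (simp add: Z_def V_def)
  have "u_fps * fps_deriv Z = u_fps * (x_fps * V)"
    unfolding Z_def binomial_series_deriv unfolding Z_def[symmetric] unfolding Z by algebra
  then have Z': "fps_deriv Z = x_fps * V"
    using u_fps_nonzero by simp
  have P': "u_fps * fps_deriv P = N * P + R" using cycle_prod_deriv[OF assms(1)]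
      unfolding P_def N_def R_def n_def .
  define F where "F = Z * P"
  define G where "G = Z * R"
  have "fps_X * (Z * cut_join 1 k I) = Z * (fps_X * cut_join 1 k I)" by (simp only: mult_ac)
  also have "\<dots> = Z * ((N + x_fps) * fps_X * fps_deriv P
     - fps_X^2 * fps_deriv R + (N - x_fps) * fps_X * R - 2 * N * P)"
    using cut_join_1[OF assms(1) pos] unfolding P_def R_def N_def n_def by simp
  also have "\<dots> = N * (fps_X * fps_deriv F) - fps_X * (fps_X * fps_deriv G - N * G) - 2 * (N * F)"
    unfolding F_def G_def fps_deriv_mult Z' using Z P' by algebra
  finally have "(fps_X * (Z * cut_join 1 k I)) $ Suc n = \<dots> $ Suc n" by (rule arg_cong)
  also have "\<dots> = of_nat n * (of_nat (Suc n) * F $ Suc n) - 2 * (of_nat n * F $ Suc n)"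
    unfolding N_def mult_2 fps_sub_nth fps_add_nth of_nat_mult_nth X_deriv_nth fps_X_mult_nth
        by simp
  finally show ?thesis by (simp add: n_def P_def F_def algebra_simps)
qed

lemma cut_join_2_coeff:
  assumes "finite I" "I \<noteq> {}" and pos: "\<And>i. i \<in> I \<Longrightarrow> k i \<ge> 3"
  shows "(binomial_series poly_x * cut_join 2 k I) $ (sum k I - 1)
    = (fps_const poly_x * fps_X ^ 2 * binomial_series (poly_x - 2)
        * (2 * fps_const poly_x + fps_const poly_x * fps_X + fps_X) * cycle_prod k I) $ sum k I"
proof -
  define P where "P = cycle_prod k I"
  define R where "R = minor_sum k I"
  define n where "n = sum k I"
  define N :: "rat poly fps" where "N = of_nat n"
  define V where "V = binomial_series (poly_x - 2)"
  \<comment> \<open>H is found by comparing coefficients with y H' - N H: the term in R' forces the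
    coefficient of R, namely u (1 - u^2) = - u y (y + 2), and the terms in R then force that of P.
    The terms in P that remain form the series of the theorem.\<close>
  define H where "H = V * (- u_fps * fps_X * (fps_X + 2) * R
      + u_fps * (2 * u_fps - N * fps_X - x_fps * fps_X * (fps_X + 2)) * P)"
  have "k i > 0" if "i \<in> I" for i using pos[OF that] by simp
  then have n0: "n > 0" unfolding n_def using assms(1,2) by (meson sum_pos)
  have Z: "binomial_series poly_x = u_fps ^ 2 * V"
    using binomial_series_add_1[of "poly_x - 1"] binomial_series_add_1[of "poly_x - 2"]
    by (simp add: V_def power2_eq_square mult.assoc)
  have V': "u_fps * fps_deriv V = (x_fps - 2) * V"
    unfolding V_def binomial_series_deriv by (simp add: numeral_fps_const flip: fps_const_sub)
  have P': "u_fps * fps_deriv P = N * P + R" using cycle_prod_deriv[OF assms(1)]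
      unfolding P_def N_def R_def n_def .
  have "fps_deriv N = 0" by (simp add: N_def)
  then have H': "fps_deriv H = fps_deriv V
      * (- u_fps * fps_X * (fps_X + 2) * R
      + u_fps * (2 * u_fps - N * fps_X - x_fps * fps_X * (fps_X + 2)) * P)
     + V * (- (fps_X * (fps_X + 2) + u_fps * (2 * fps_X + 2)) * R
         - u_fps * fps_X * (fps_X + 2) * fps_deriv R
       + ((2 * u_fps - N * fps_X - x_fps * fps_X * (fps_X + 2))
           + u_fps * (2 - N - x_fps * (2 * fps_X + 2))) * P
       + (2 * u_fps - N * fps_X - x_fps * fps_X * (fps_X + 2)) * (u_fps * fps_deriv P))"
    unfolding H_def by (simp add: algebra_simps del: fps_deriv_eq_0_iff)
  have "fps_X * (binomial_series poly_x * cut_join 2 k I)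
      = V * (u_fps ^ 2 * fps_X * cut_join 2 k I)" unfolding Z by (simp only: mult_ac)
  also have "\<dots> = V * (fps_X * (N^2 * P + 2 * N * R + (1 - u_fps ^ 2) * (u_fps * fps_deriv R - N * R)
       - 3 * N * P + 2 * x_fps * N * P)
     + (- 3 * fps_X * (1 + u_fps ^ 2) + 2 * x_fps * fps_X * (1 - u_fps ^ 2) - 2 * (1 - u_fps ^ 3))
         * R
     - 2 * N * P)"
    using cut_join_2[OF assms(1) pos] unfolding P_def R_def N_def n_def by simp
  also have "\<dots> = (x_fps * fps_X ^ 2 * V * (2 * x_fps + x_fps * fps_X + fps_X) * P)
      + fps_X * fps_deriv H - N * H"
    unfolding H' P' unfolding H_def using V' by algebra
  finally have "(fps_X * (binomial_series poly_x * cut_join 2 k I)) $ n = \<dots> $ n" by (rule arg_cong)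
  also have "\<dots> = (x_fps * fps_X ^ 2 * V * (2 * x_fps + x_fps * fps_X + fps_X) * P) $ n"
    unfolding N_def fps_sub_nth fps_add_nth of_nat_mult_nth X_deriv_nth by simp
  \<comment> \<open>Removing the factor \<open>fps_X\<close> lowers the index by one; n > 0 makes
    \<open>n - 1\<close> a true predecessor.\<close>
  finally show ?thesis using n0 by (simp add: n_def P_def V_def)
qed

subsection \<open>Cycles of permutations\<close>

text \<open>The carrier is arbitrary, unlike in \<open>cycle_sets\<close>, because deletions pass to
  subsets.\<close>

definition cycles_on :: "'a set \<Rightarrow> ('a \<Rightarrow> 'a) \<Rightarrow> 'a set set" where
  "cycles_on S \<pi> = orbit \<pi> ` S"

text \<open>Interpolates between \<open>cycle_prod\<close>, which is the case of empty
  \<open>D\<close>, and the weight that remains when points are struck out; cycles inside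
  \<open>D\<close> are not forgotten but weigh x.\<close>

definition deletion_wt :: "'a set \<Rightarrow> 'a set \<Rightarrow> ('a \<Rightarrow> 'a) \<Rightarrow> rat poly fps" where
  "deletion_wt D S \<pi> = (\<Prod>C\<in>cycles_on S \<pi>. cycle_wt (card (C - D)))"

section \<open>Cycles as a partition of the underlying set\<close>

lemma self_in_orbit: "finite S \<Longrightarrow> \<pi> permutes S \<Longrightarrow> x \<in> orbit \<pi> x"
  by (meson permutation_permutes permutation_self_in_orbit)

lemma orbit_eq: "finite S \<Longrightarrow> \<pi> permutes S \<Longrightarrow> y \<in> orbit \<pi> x \<Longrightarrow> orbit \<pi> y = orbit \<pi> x"
  by (meson cyclic_on_orbit orbit_cyclic_eq3)

lemma orbit_eq_iff: "finite S \<Longrightarrow> \<pi> permutes S \<Longrightarrow> orbit \<pi> y = orbit \<pi> x \<longleftrightarrow> y \<in> orbit \<pi> x"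
  by (metis orbit_eq self_in_orbit)

lemma finite_cycles_on: "finite S \<Longrightarrow> finite (cycles_on S \<pi>)"
  by (simp add: cycles_on_def)

lemma cycles_onD:
  assumes "finite S" "\<pi> permutes S" "C \<in> cycles_on S \<pi>"
  shows "C \<subseteq> S" "finite C" "C \<noteq> {}" "card C > 0"
    and "x \<in> C \<Longrightarrow> orbit \<pi> x = C" "x \<in> C \<Longrightarrow> x \<in> S"
proof -
  obtain s where s: "s \<in> S" "C = orbit \<pi> s" using assms(3) by (auto simp: cycles_on_def)
  show 1: "C \<subseteq> S" using s permutes_orbit_subset[OF assms(2)] by auto
  then show 2: "finite C" using assms(1) finite_subset by auto
  show 3: "C \<noteq> {}" using s(2) orbit_nonempty[of \<pi> s] by simp
  show "card C > 0" using 2 3 by auto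
  show "x \<in> C \<Longrightarrow> orbit \<pi> x = C" using s orbit_eq assms by metis
  show "x \<in> C \<Longrightarrow> x \<in> S" using 1 by auto
qed

lemma cycles_on_disjoint:
  assumes "finite S" "\<pi> permutes S" "C \<in> cycles_on S \<pi>" "C' \<in> cycles_on S \<pi>" "C \<noteq> C'"
  shows "C \<inter> C' = {}"
  using cycles_onD(5)[OF assms(1,2)] assms(3-) by blast

lemma Union_cycles_on:
  assumes "finite S" "\<pi> permutes S"
  shows "\<Union>(cycles_on S \<pi>) = S"
  using cycles_onD(1)[OF assms] self_in_orbit[OF assms] by (auto simp: cycles_on_def)

lemma sum_over_cycles:
  assumes "finite S" "\<pi> permutes S"
  shows "sum f S = (\<Sum>C\<in>cycles_on S \<pi>. sum f C)"
  using sum.Union_disjoint[of "cycles_on S \<pi>" f] cycles_onD(2)[OF assms]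
      cycles_on_disjoint[OF assms]
  unfolding Union_cycles_on[OF assms] by auto

lemma sum_card_cycles:
  assumes "finite S" "\<pi> permutes S"
  shows "sum card (cycles_on S \<pi>) = card S"
  using sum_over_cycles[OF assms, of "\<lambda>_. 1 :: nat"] by simp

section \<open>Inserting a point into a cycle\<close>

text \<open>The new permutation follows \<sigma> except that b stands just in front of e: the
  predecessor of e goes to b, and b goes to e.\<close>

lemma orbit_insert_point:
  assumes "finite S" "\<sigma> permutes S" "b \<notin> S" "e \<in> S"
  shows "orbit (transpose b e \<circ> \<sigma>) b = insert b (orbit \<sigma> e)" (is "orbit ?\<tau> b = _")
proof (intro subset_antisym subsetI)
  have b: "\<sigma> b = b" using assms by (auto simp: permutes_def)
  have e: "e \<in> orbit \<sigma> e" by (rule self_in_orbit[OF assms(1,2)])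
  {
    fix y assume "y \<in> orbit ?\<tau> b"
    then show "y \<in> insert b (orbit \<sigma> e)"
    proof induction
      case base
      then show ?case using b e by simp
    next
      case (step y)
      then show ?case using b e by (auto simp: transpose_def intro: orbit.intros)
    qed
  }
  have e': "e \<in> orbit ?\<tau> b" using orbit.base[of ?\<tau> b] b by simp
  have step: "\<sigma> y \<in> orbit ?\<tau> b" if "y \<in> orbit ?\<tau> b" "y \<in> orbit \<sigma> e" for y
  proof -
    have "\<sigma> y \<in> S" using that(2) permutes_orbit_subset[OF assms(2,4)]
        permutes_in_image[OF assms(2)] by auto
    then have "\<sigma> y \<noteq> b" using assms(3) by auto
    then show ?thesis using e' orbit.step[OF that(1)] by (cases "\<sigma> y = e") auto
  qed
  have "y \<in> orbit ?\<tau> b" if "y \<in> orbit \<sigma> e" for y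
    using that
  proof induction
    case base
    then show ?case using step[OF e' e] .
  next
    case (step y)
    then show ?case using \<open>\<And>y. y \<in> orbit ?\<tau> b \<Longrightarrow> y \<in> orbit \<sigma> e \<Longrightarrow> \<sigma> y \<in> orbit ?\<tau> b\<close> by blast
  qed
  moreover have "b \<in> orbit ?\<tau> b"
    by (rule self_in_orbit[of "insert b S"])
        (use assms in \<open>auto intro!: permutes_compose permutes_swap_id permutes_subset[OF assms(2)]\<close>)
  ultimately show "y \<in> orbit ?\<tau> b" if "y \<in> insert b (orbit \<sigma> e)" for y using that by auto
qed

text \<open>Only the cycle of e changes: the other orbits contain neither b nor e, so both
  permutations agree on them.\<close>

lemma cycles_on_insert_point:
  assumes "finite S" "\<sigma> permutes S" "b \<notin> S" "e \<in> S"
  shows "cycles_on (insert b S) (transpose b e \<circ> \<sigma>)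
    = insert (insert b (orbit \<sigma> e)) (cycles_on S \<sigma> - {orbit \<sigma> e})" (is "cycles_on _ ?\<tau> = _")
proof -
  have \<tau>: "?\<tau> permutes insert b S"
    using assms by (auto intro!: permutes_compose permutes_swap_id permutes_subset[OF assms(2)])
  note b = orbit_insert_point[OF assms]
  have in_orbit: "orbit ?\<tau> x = insert b (orbit \<sigma> e)" if "x \<in> orbit \<sigma> e" for x
    using orbit_eq[OF _ \<tau>, of x b] that assms(1) unfolding b by simp
  have out: "orbit ?\<tau> x = orbit \<sigma> x" if "x \<in> S" "x \<notin> orbit \<sigma> e" for x
  proof (rule orbit_cong[OF self_in_orbit[OF assms(1,2)]])
    fix s assume s: "s \<in> orbit \<sigma> x"
    then have "\<sigma> s \<in> orbit \<sigma> x" by (rule orbit.step)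
    moreover have "e \<notin> orbit \<sigma> x"
      using that(2) orbit_eq_iff[OF assms(1,2)] self_in_orbit[OF assms(1,2)] by metis
    moreover have "b \<notin> orbit \<sigma> x" using permutes_orbit_subset[OF assms(2) that(1)] assms(3) by auto
    ultimately have "\<sigma> s \<noteq> b" "\<sigma> s \<noteq> e" by auto
    then show "?\<tau> s = \<sigma> s" by simp
  qed
  have "cycles_on (insert b S) ?\<tau> = insert (insert b (orbit \<sigma> e))
      (orbit ?\<tau> ` orbit \<sigma> e \<union> orbit ?\<tau> ` (S - orbit \<sigma> e))"
    using permutes_orbit_subset[OF assms(2,4)] by (auto simp: cycles_on_def b)
  also have "orbit ?\<tau> ` orbit \<sigma> e = {insert b (orbit \<sigma> e)}"
    using in_orbit orbit_nonempty[of \<sigma> e] by auto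
  also have "orbit ?\<tau> ` (S - orbit \<sigma> e) = orbit \<sigma> ` (S - orbit \<sigma> e)"
    using out by (intro image_cong) auto
  also have "\<dots> = cycles_on S \<sigma> - {orbit \<sigma> e}"
    using orbit_eq_iff[OF assms(1,2), symmetric] by (auto simp: cycles_on_def)
  finally show ?thesis unfolding Un_insert_left Un_empty_left insert_absorb2 .
qed

lemma cycles_on_insert_fixed:
  assumes "\<sigma> permutes S" "b \<notin> S"
  shows "cycles_on (insert b S) \<sigma> = insert {b} (cycles_on S \<sigma>)"
proof -
  have "\<sigma> b = b" using assms by (auto simp: permutes_def)
  then have "orbit \<sigma> b = {b}" by (simp add: orbit_eq_singleton_iff)
  then show ?thesis by (simp add: cycles_on_def)
qed

lemma card_cycles_insert:
  assumes "finite S" "\<sigma> permutes S" "b \<notin> S" "e \<in> insert b S"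
  shows "card (cycles_on (insert b S) (transpose b e \<circ> \<sigma>))
      = card (cycles_on S \<sigma>) + (if e = b then 1 else 0)"
proof -
  have nb: "b \<notin> C" if "C \<in> cycles_on S \<sigma>" for C using cycles_onD(1)[OF assms(1,2) that] assms(3)
      by auto
  have fin: "finite (cycles_on S \<sigma>)" using assms by (simp add: finite_cycles_on)
  show ?thesis
  proof (cases "e = b")
    case True
    then have "{b} \<notin> cycles_on S \<sigma>" using nb by blast
    then show ?thesis using True fin by (simp add: cycles_on_insert_fixed[OF assms(2,3)])
  next
    case False
    then have e: "e \<in> S" using assms by auto
    have "insert b (orbit \<sigma> e) \<notin> cycles_on S \<sigma>" using nb by blast
    moreover have "orbit \<sigma> e \<in> cycles_on S \<sigma>" using e by (auto simp: cycles_on_def)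
    moreover from this have "card (cycles_on S \<sigma>) > 0" using fin by (auto simp: card_gt_0_iff)
    ultimately show ?thesis using False fin
      by (simp add: cycles_on_insert_point[OF assms(1-3) e])
  qed
qed

text \<open>A point that is inserted and deleted at once leaves the weights alone. As a fixed point
  it becomes an empty cycle, and \<open>cycle_wt 0\<close> supplies exactly the factor x that the
  additional cycle in \<open>card_cycles_insert\<close> gives on the other side.\<close>

lemma deletion_wt_insert:
  assumes "finite S" "\<sigma> permutes S" "b \<notin> S" "e \<in> insert b S"
  shows "deletion_wt (insert b D) (insert b S) (transpose b e \<circ> \<sigma>)
      = (if e = b then x_fps else 1) * deletion_wt D S \<sigma>"
proof -
  have nb: "b \<notin> C" if "C \<in> cycles_on S \<sigma>" for C using cycles_onD(1)[OF assms(1,2) that] assms(3)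
      by auto
  have fin: "finite (cycles_on S \<sigma>)" using assms by (simp add: finite_cycles_on)
  have same: "C - insert b D = C - D" if "C \<in> cycles_on S \<sigma>" for C using nb[OF that] by auto
  show ?thesis
  proof (cases "e = b")
    case True
    then have "{b} \<notin> cycles_on S \<sigma>" using nb by blast
    moreover have "cycle_wt 0 = x_fps" by (simp add: cycle_wt_def)
    ultimately show ?thesis using True fin same
      by (simp add: deletion_wt_def cycles_on_insert_fixed[OF assms(2,3)])
  next
    case False
    then have e: "e \<in> S" using assms by auto
    have 1: "insert b (orbit \<sigma> e) \<notin> cycles_on S \<sigma> - {orbit \<sigma> e}" using nb by blast
    have 2: "orbit \<sigma> e \<in> cycles_on S \<sigma>" using e by (auto simp: cycles_on_def)
    have 3: "insert b (orbit \<sigma> e) - insert b D = orbit \<sigma> e - D" using nb[OF 2] by auto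
    show ?thesis using False fin 1 2 same
      by (simp add: deletion_wt_def cycles_on_insert_point[OF assms(1-3) e] 3 prod.remove[OF fin 2])
  qed
qed

section \<open>Multiplication by a transposition\<close>

text \<open>From b the orbit runs through the old cycle of b; the last step, which would return to
  b, is diverted to a, and the cycle of a follows.\<close>

lemma orbit_join:
  assumes "finite S" "\<omega> permutes S" "a \<in> S" "b \<in> S" "a \<notin> orbit \<omega> b"
  shows "orbit (transpose a b \<circ> \<omega>) b = orbit \<omega> a \<union> orbit \<omega> b" (is "orbit ?\<tau> b = _")
proof (intro subset_antisym subsetI)
  note self = self_in_orbit[OF assms(1,2)]
  have \<tau>: "?\<tau> permutes S" by (intro permutes_compose assms permutes_swap_id)
  have b: "b \<in> orbit ?\<tau> b" by (rule self_in_orbit[OF assms(1) \<tau>])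
  have ba: "b \<notin> orbit \<omega> a" using assms(5) orbit_eq_iff[OF assms(1,2)] self by metis
  {
    fix y assume "y \<in> orbit ?\<tau> b"
    then show "y \<in> orbit \<omega> a \<union> orbit \<omega> b"
      by induction (auto simp: transpose_def intro: orbit.intros self)
  }
  have stepB: "\<omega> y \<in> orbit ?\<tau> b" if "y \<in> orbit ?\<tau> b" "y \<in> orbit \<omega> b" for y
  proof -
    have "\<omega> y \<noteq> a" using orbit.step[OF that(2)] assms(5) by auto
    then show ?thesis using b orbit.step[OF that(1)] by (cases "\<omega> y = b") auto
  qed
  have B: "y \<in> orbit ?\<tau> b" if "y \<in> orbit \<omega> b" for y
    using that by induction (use stepB b self in blast)+
  \<comment> \<open>The predecessor of b, at which the walk changes over to the cycle of a.\<close>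
  obtain y where y: "y \<in> orbit \<omega> b" "\<omega> y = b"
    using orbit.cases[OF self[of b]] self by metis
  have a: "a \<in> orbit ?\<tau> b" using orbit.step[OF B[OF y(1)]] y(2) by simp
  have stepA: "\<omega> y \<in> orbit ?\<tau> b" if "y \<in> orbit ?\<tau> b" "y \<in> orbit \<omega> a" for y
  proof -
    have "\<omega> y \<noteq> b" using orbit.step[OF that(2)] ba by auto
    then show ?thesis using a orbit.step[OF that(1)] by (cases "\<omega> y = a") auto
  qed
  have A: "y \<in> orbit ?\<tau> b" if "y \<in> orbit \<omega> a" for y
    using that by induction (use stepA a self in blast)+
  show "y \<in> orbit ?\<tau> b" if "y \<in> orbit \<omega> a \<union> orbit \<omega> b" for y using A B that by auto
qed

lemma cycles_on_join:
  assumes "finite S" "\<omega> permutes S" "a \<in> S" "b \<in> S" "a \<notin> orbit \<omega> b"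
  shows "cycles_on S (transpose a b \<circ> \<omega>)
    = insert (orbit \<omega> a \<union> orbit \<omega> b) (cycles_on S \<omega> - {orbit \<omega> a} - {orbit \<omega> b})"
        (is "cycles_on S ?\<tau> = _")
proof -
  have \<tau>: "?\<tau> permutes S" by (intro permutes_compose assms permutes_swap_id)
  let ?U = "orbit \<omega> a \<union> orbit \<omega> b"
  have U: "?U \<subseteq> S" using permutes_orbit_subset[OF assms(2)] assms(3,4) by auto
  have in_orbit: "orbit ?\<tau> x = ?U" if "x \<in> ?U" for x
    using orbit_eq[OF assms(1) \<tau>, of x b] that unfolding orbit_join[OF assms] by simp
  have out: "orbit ?\<tau> x = orbit \<omega> x" if "x \<in> S" "x \<notin> ?U" for x
  proof (rule orbit_cong[OF self_in_orbit[OF assms(1,2)]])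
    fix s assume s: "s \<in> orbit \<omega> x"
    then have "\<omega> s \<in> orbit \<omega> x" by (rule orbit.step)
    moreover have "a \<notin> orbit \<omega> x" "b \<notin> orbit \<omega> x"
      using that(2) orbit_eq_iff[OF assms(1,2)] self_in_orbit[OF assms(1,2)] by blast+
    ultimately have "\<omega> s \<noteq> b" "\<omega> s \<noteq> a" by auto
    then show "?\<tau> s = \<omega> s" by simp
  qed
  have "cycles_on S ?\<tau> = orbit ?\<tau> ` ?U \<union> orbit ?\<tau> ` (S - ?U)"
    using U unfolding cycles_on_def by blast
  also have "orbit ?\<tau> ` ?U = {?U}"
    using in_orbit orbit_nonempty[of \<omega> a] by auto
  also have "orbit ?\<tau> ` (S - ?U) = orbit \<omega> ` (S - ?U)"
    using out by (intro image_cong) auto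
  also have "\<dots> = cycles_on S \<omega> - {orbit \<omega> a} - {orbit \<omega> b}"
    using orbit_eq_iff[OF assms(1,2), symmetric] by (auto simp: cycles_on_def)
  finally show ?thesis unfolding Un_insert_left Un_empty_left .
qed

text \<open>At b the powers of the two permutations agree below exponent d. At exponent d the value
  a is exchanged for b, so the orbit closes after d points.\<close>

lemma orbit_cut:
  assumes "finite S" "\<omega> permutes S" "0 < d" "d < card (orbit \<omega> b)" "a = (\<omega> ^^ d) b"
  shows "orbit (transpose a b \<circ> \<omega>) b = (\<lambda>i. (\<omega> ^^ i) b) ` {..<d}"
    and "card ((\<lambda>i. (\<omega> ^^ i) b) ` {..<d}) = d"
    and "a \<notin> (\<lambda>i. (\<omega> ^^ i) b) ` {..<d}"
proof -
  let ?\<tau> = "transpose a b \<circ> \<omega>"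
  have self: "b \<in> orbit \<omega> b" by (rule self_in_orbit[OF assms(1,2)])
  define k where "k = funpow_dist1 \<omega> b b"
  have inj: "inj_on (\<lambda>i. (\<omega> ^^ i) b) {0..<k}"
    unfolding k_def using inj_on_funpow_dist1[OF self] .
  have "card (orbit \<omega> b) = k"
    using orbit_conv_funpow_dist1[OF self] card_image[OF inj] unfolding k_def by simp
  then have dk: "d < k" using assms by simp
  have ne: "(\<omega> ^^ i) b \<noteq> (\<omega> ^^ j) b" if "i < k" "j < k" "i \<noteq> j" for i j
    using inj that unfolding inj_on_def by auto
  have pow: "(?\<tau> ^^ i) b = (\<omega> ^^ i) b" if "i < d" for i
    using that
  proof (induction i)
    case (Suc i)
    have "(\<omega> ^^ Suc i) b \<noteq> a" "(\<omega> ^^ Suc i) b \<noteq> b"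
      using ne[of "Suc i" d] ne[of "Suc i" 0] Suc.prems dk assms(5) by auto
    then show ?case using Suc by simp
  qed simp
  obtain l where l: "d = Suc l" using assms(3) by (cases d) auto
  have "(?\<tau> ^^ d) b = transpose a b ((\<omega> ^^ d) b)" using pow[of l] by (simp add: l)
  then have "(?\<tau> ^^ d) b = b" using assms(5) by simp
  from orbit_altdef_bounded[OF this assms(3)]
  have "orbit ?\<tau> b = (\<lambda>i. (?\<tau> ^^ i) b) ` {..<d}" by auto
  also have "\<dots> = (\<lambda>i. (\<omega> ^^ i) b) ` {..<d}" by (intro image_cong refl) (simp add: pow)
  finally show "orbit ?\<tau> b = (\<lambda>i. (\<omega> ^^ i) b) ` {..<d}" .
  have "inj_on (\<lambda>i. (\<omega> ^^ i) b) {..<d}" using inj by (rule inj_on_subset) (use dk in auto)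
  then show "card ((\<lambda>i. (\<omega> ^^ i) b) ` {..<d}) = d" by (simp add: card_image)
  show "a \<notin> (\<lambda>i. (\<omega> ^^ i) b) ` {..<d}" using ne dk assms(5) by auto
qed

text \<open>Parametrises the points a in the cycle of b by their distance from b, which is the size
  of the piece containing b after the cut.\<close>

lemma bij_betw_funpow_orbit:
  assumes "finite S" "\<omega> permutes S"
  shows "bij_betw (\<lambda>d. (\<omega> ^^ d) b) {1..<card (orbit \<omega> b)} (orbit \<omega> b - {b})"
proof -
  have self: "b \<in> orbit \<omega> b" by (rule self_in_orbit[OF assms(1,2)])
  define k where "k = funpow_dist1 \<omega> b b"
  have inj: "inj_on (\<lambda>i. (\<omega> ^^ i) b) {0..<k}"
    unfolding k_def using inj_on_funpow_dist1[OF self] .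
  have orb: "orbit \<omega> b = (\<lambda>i. (\<omega> ^^ i) b) ` {0..<k}"
    using orbit_conv_funpow_dist1[OF self] unfolding k_def .
  have "k > 0" by (simp add: k_def)
  have "card (orbit \<omega> b) = k" using orb card_image[OF inj] by simp
  moreover have "bij_betw (\<lambda>i. (\<omega> ^^ i) b) ({0..<k} - {0}) (orbit \<omega> b - {(\<omega> ^^ 0) b})"
    using inj orb \<open>k > 0\<close> by (intro bij_betw_DiffI)
        (auto simp: bij_betw_def intro!: image_eqI[of _ _ 0])
  moreover have "{0..<k} - {0} = {1..<k}" by auto
  ultimately show ?thesis by simp
qed

text \<open>Reduced to \<open>cycles_on_join\<close>: multiplying by the same transposition again
  gives back \<omega>, so the cycles of a and b in the product must join to the cycle of b in
  \<omega>.\<close>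

lemma cycles_on_cut:
  assumes "finite S" "\<omega> permutes S" "b \<in> S" "0 < d" "d < card (orbit \<omega> b)" "a = (\<omega> ^^ d) b"
  defines "E \<equiv> (\<lambda>i. (\<omega> ^^ i) b) ` {..<d}"
  shows "cycles_on S (transpose a b \<circ> \<omega>) = insert E
      (insert (orbit \<omega> b - E) (cycles_on S \<omega> - {orbit \<omega> b}))"
    (is "cycles_on S ?\<tau> = _")
proof -
  note E = orbit_cut[OF assms(1,2,4,5,6), folded E_def]
  have a: "a \<in> orbit \<omega> b" unfolding assms(6) by (intro funpow_in_orbit self_in_orbit[OF assms(1,2)])
  then have aS: "a \<in> S" using permutes_orbit_subset[OF assms(2,3)] by auto
  have \<tau>: "?\<tau> permutes S" by (intro permutes_compose assms permutes_swap_id aS)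
  have inv: "transpose a b \<circ> ?\<tau> = \<omega>" by (simp add: fun_eq_iff)
  have "a \<notin> orbit ?\<tau> b" using E by simp
  note J = orbit_join[OF assms(1) \<tau> aS assms(3) this, unfolded inv]
    cycles_on_join[OF assms(1) \<tau> aS assms(3) this, unfolded inv]
  have cyc: "orbit ?\<tau> a \<in> cycles_on S ?\<tau>" "orbit ?\<tau> b \<in> cycles_on S ?\<tau>"
    using aS assms(3) by (auto simp: cycles_on_def)
  have ne: "orbit ?\<tau> a \<noteq> orbit ?\<tau> b" using \<open>a \<notin> orbit ?\<tau> b\<close> self_in_orbit[OF assms(1) \<tau>] by metis
  have disj: "orbit ?\<tau> a \<inter> orbit ?\<tau> b = {}" using cycles_on_disjoint[OF assms(1) \<tau> cyc ne] .
  then have A: "orbit ?\<tau> a = orbit \<omega> b - E" using J(1) E(1) by auto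
  have "orbit \<omega> b \<notin> cycles_on S ?\<tau>"
  proof
    assume *: "orbit \<omega> b \<in> cycles_on S ?\<tau>"
    have "orbit \<omega> b = orbit ?\<tau> b"
      using cycles_onD(5)[OF assms(1) \<tau> *] self_in_orbit[OF assms(1,2)] by metis
    then show False using a \<open>a \<notin> orbit ?\<tau> b\<close> by auto
  qed
  then have "cycles_on S ?\<tau> - {orbit ?\<tau> a} - {orbit ?\<tau> b} = cycles_on S \<omega> - {orbit \<omega> b}"
    using J by auto
  then have "cycles_on S ?\<tau> = insert (orbit ?\<tau> b)
      (insert (orbit ?\<tau> a) (cycles_on S \<omega> - {orbit \<omega> b}))"
    using cyc by blast
  then show ?thesis unfolding A E(1) .
qed

section \<open>Weights after a join or a cut\<close>

text \<open>The deleted points all lie in the joined cycle, so every other cycle keeps its ordinary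
  factor.\<close>

lemma deletion_wt_join:
  assumes "finite S" "\<omega> permutes S" "A \<in> cycles_on S \<omega>" "B \<in> cycles_on S \<omega>" "A \<noteq> B" "a \<in> A" "b \<in>
      B" "D \<subseteq> {a, b}"
  shows "deletion_wt D S (transpose a b \<circ> \<omega>)
     = cycle_wt (card A + card B - card D) * cycle_prod card (cycles_on S \<omega> - {A} - {B})"
proof -
  note A = cycles_onD[OF assms(1-3)] and B = cycles_onD[OF assms(1,2,4)]
  have disj: "A \<inter> B = {}" using cycles_on_disjoint[OF assms(1-5)] .
  have oa: "orbit \<omega> a = A" and ob: "orbit \<omega> b = B" using A(5) B(5) assms by auto
  have "a \<notin> B" using assms disj by auto
  then have cyc: "cycles_on S (transpose a b \<circ> \<omega>) = insert (A \<union> B) (cycles_on S \<omega> - {A} - {B})"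
    using cycles_on_join[OF assms(1,2), of a b] A(6) B(6) assms(6,7) by (simp add: oa ob)
  have "A \<union> B \<notin> cycles_on S \<omega> - {A} - {B}"
    using cycles_onD(5)[OF assms(1,2), of "A \<union> B" a] oa assms(6) by auto
  then have "deletion_wt D S (transpose a b \<circ> \<omega>)
      = cycle_wt (card (A \<union> B - D)) * (\<Prod>C\<in>cycles_on S \<omega> - {A} - {B}. cycle_wt (card (C - D)))"
    unfolding deletion_wt_def cyc by (subst prod.insert) (auto simp: finite_cycles_on assms)
  also have "card (A \<union> B - D) = card A + card B - card D"
    using assms A(2) B(2) disj by (subst card_Diff_subset)
        (auto simp: card_Un_disjoint intro: finite_subset)
  also have "(\<Prod>C\<in>cycles_on S \<omega> - {A} - {B}. cycle_wt (card (C - D)))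
      = cycle_prod card (cycles_on S \<omega> - {A} - {B})"
    unfolding cycle_prod_def
  proof (rule prod.cong[OF refl])
    fix C assume C: "C \<in> cycles_on S \<omega> - {A} - {B}"
    then have "C \<inter> A = {}" "C \<inter> B = {}" using cycles_on_disjoint[OF assms(1,2)] assms(3,4) by blast+
    then have "C - D = C" using assms by auto
    then show "cycle_wt (card (C - D)) = u_fps ^ card C - 1"
      using cycles_onD(4)[OF assms(1,2), of C] C by (auto simp: cycle_wt_def)
  qed
  finally show ?thesis .
qed

text \<open>The piece with b has d points and loses b; the other piece loses the rest of
  \<open>D\<close>. Counting by e = d - 1 leaves e and \<open>card C - card D - e\<close> points,
  the form used in \<open>cut_join\<close>.\<close>

lemma deletion_wt_cut:
  assumes "finite S" "\<omega> permutes S" "C \<in> cycles_on S \<omega>" "b \<in> C" "0 < d" "d < card C" "a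
      = (\<omega> ^^ d) b"
    and "b \<in> D" "D \<subseteq> {a, b}"
  shows "deletion_wt D S (transpose a b \<circ> \<omega>)
     = cycle_wt (d - 1) * cycle_wt (card C - card D - (d - 1))
         * cycle_prod card (cycles_on S \<omega> - {C})"
proof -
  note C = cycles_onD[OF assms(1-3)]
  have ob: "orbit \<omega> b = C" using C(5) assms by auto
  define E where "E = (\<lambda>i. (\<omega> ^^ i) b) ` {..<d}"
  note E = orbit_cut[OF assms(1,2,5) _ assms(7), unfolded ob, OF assms(6), folded E_def]
  have cyc: "cycles_on S (transpose a b \<circ> \<omega>) = insert E (insert (C - E) (cycles_on S \<omega> - {C}))"
    using cycles_on_cut[OF assms(1,2) C(6) assms(5) _ assms(7)] assms(4,6) by (simp add: ob E_def)
  have a: "a \<in> C" using funpow_in_orbit[OF self_in_orbit[OF assms(1,2)], of d b] ob assms(7) by simp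
  have EC: "E \<subseteq> C" unfolding E_def using funpow_in_orbit[OF self_in_orbit[OF assms(1,2)], of _ b]
      ob by auto
  have bE: "b \<in> E" unfolding E_def using assms(5) by (auto intro!: image_eqI[of _ _ 0])
  have finE: "finite E" by (simp add: E_def)
  have ab: "a \<noteq> b" using E bE by auto
  have not_cycle: "F \<notin> cycles_on S \<omega> - {C}" if "x \<in> F" "x \<in> C" for F x
    using cycles_on_disjoint[OF assms(1,2) _ assms(3)] that by blast
  have 1: "E \<notin> insert (C - E) (cycles_on S \<omega> - {C})" using not_cycle[of b E] bE EC by auto
  have 2: "C - E \<notin> cycles_on S \<omega> - {C}" using not_cycle[of a "C - E"] a E by auto
  have "deletion_wt D S (transpose a b \<circ> \<omega>)
      = cycle_wt (card (E - D)) * (cycle_wt (card (C - E - D))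
      * (\<Prod>F\<in>cycles_on S \<omega> - {C}. cycle_wt (card (F - D))))"
    unfolding deletion_wt_def cyc using 1 2 by (simp add: finite_cycles_on assms)
  also have "E - D = E - {b}" using assms E by auto
  also have "card (E - {b}) = d - 1" using E(2) bE by simp
  also have "card (C - E - D) = card C - card D - (d - 1)"
  proof -
    have "C - E - D = C - E - (D - {b})" using bE by auto
    also have "card \<dots> = card (C - E) - card (D - {b})"
      using assms E a by (intro card_Diff_subset) (auto intro: finite_subset)
    also have "card (D - {b}) = card D - 1" using assms by simp
    also have "card (C - E) = card C - d" using E(2) EC finE by (simp add: card_Diff_subset)
    also have "card D > 0" using assms by (auto simp: card_gt_0_iff intro: finite_subset)
    then have "card C - d - (card D - 1) = card C - card D - (d - 1)" using assms(5) by simp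
    finally show ?thesis .
  qed
  also have "(\<Prod>F\<in>cycles_on S \<omega> - {C}. cycle_wt (card (F - D)))
      = cycle_prod card (cycles_on S \<omega> - {C})"
    unfolding cycle_prod_def
  proof (rule prod.cong[OF refl])
    fix F assume F: "F \<in> cycles_on S \<omega> - {C}"
    then have "F \<inter> C = {}" using cycles_on_disjoint[OF assms(1,2)] assms(3) by blast
    then have "F - D = F" using assms a by auto
    then show "cycle_wt (card (F - D)) = u_fps ^ card F - 1"
      using cycles_onD(4)[OF assms(1,2), of F] F by (auto simp: cycle_wt_def)
  qed
  finally show ?thesis by (simp only: mult.assoc)
qed

text \<open>With \<open>D\<close> as a parameter one statement serves both uses: \<open>{b}\<close>
  with s = 1 for long cycles, \<open>{a, b}\<close> with s = 2 for type [2, n-2]. For fixed b, the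
  points a outside its cycle give joins, and those inside give one cut for each distance d.\<close>

lemma sum_deletion_wt:
  assumes "finite S" "\<omega> permutes S"
    and D: "\<And>a b. a \<noteq> b \<Longrightarrow> b \<in> D a b \<and> D a b \<subseteq> {a, b} \<and> card (D a b) = s"
  shows "(\<Sum>b\<in>S. \<Sum>a\<in>S-{b}. deletion_wt (D a b) S (transpose a b \<circ> \<omega>))
      = cut_join s card (cycles_on S \<omega>)"
proof -
  let ?\<C> = "cycles_on S \<omega>"
  let ?f = "\<lambda>a b. deletion_wt (D a b) S (transpose a b \<circ> \<omega>)"
  have fin: "finite ?\<C>" using assms by (simp add: finite_cycles_on)
  have inner: "(\<Sum>a\<in>S-{b}. ?f a b) =
     (\<Sum>A\<in>?\<C>-{B}. of_nat (card A) * cycle_wt (card B + card A - s)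
         * cycle_prod card (?\<C> - {B} - {A}))
     + (\<Sum>e<card B - 1. cycle_wt e * cycle_wt (card B - s - e)) * cycle_prod card (?\<C> - {B})"
    if B: "B \<in> ?\<C>" "b \<in> B" for B b
  proof -
    note BD = cycles_onD[OF assms(1,2) B(1)]
    have "S - {b} = (S - B) \<union> (B - {b})" using B BD by auto
    then have "(\<Sum>a\<in>S-{b}. ?f a b) = (\<Sum>a\<in>S - B. ?f a b) + (\<Sum>a\<in>B - {b}. ?f a b)"
      using sum.union_disjoint[of "S - B" "B - {b}" "\<lambda>a. ?f a b"] assms(1) BD(2) by auto
    also have "S - B = \<Union>(?\<C> - {B})"
    proof (intro subset_antisym subsetI)
      fix x assume "x \<in> S - B"
      then show "x \<in> \<Union>(?\<C> - {B})" using Union_cycles_on[OF assms(1,2)] by auto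
    next
      fix x assume "x \<in> \<Union>(?\<C> - {B})"
      then obtain A where "x \<in> A" "A \<in> ?\<C>" "A \<noteq> B" by auto
      then show "x \<in> S - B"
        using cycles_on_disjoint[OF assms(1,2) _ B(1)] cycles_onD(6)[OF assms(1,2)] by auto
    qed
    also have "(\<Sum>a\<in>\<Union>(?\<C> - {B}). ?f a b) = (\<Sum>A\<in>?\<C>-{B}. \<Sum>a\<in>A. ?f a b)"
      using cycles_onD(2)[OF assms(1,2)] cycles_on_disjoint[OF assms(1,2)]
      by (subst sum.Union_disjoint) auto
    also have "\<dots> = (\<Sum>A\<in>?\<C>-{B}. of_nat (card A) * cycle_wt (card B + card A - s)
        * cycle_prod card (?\<C> - {B} - {A}))"
    proof (rule sum.cong[OF refl])
      fix A assume A: "A \<in> ?\<C> - {B}"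
      have "?f a b = cycle_wt (card B + card A - s) * cycle_prod card (?\<C> - {B} - {A})" if "a \<in> A"
          for a
      proof -
        have "a \<noteq> b" using cycles_on_disjoint[OF assms(1,2)] A B that by blast
        then show ?thesis using deletion_wt_join[OF assms(1,2) _ B(1) _ that B(2), of "D a b"]
            D[of a b] A
          by (simp add: add.commute Diff_insert2[symmetric] insert_commute)
      qed
      then show "(\<Sum>a\<in>A. ?f a b) = of_nat (card A) * cycle_wt (card B + card A - s)
          * cycle_prod card (?\<C> - {B} - {A})"
        by (simp add: mult.assoc)
    qed
    also have "(\<Sum>a\<in>B - {b}. ?f a b) = (\<Sum>d\<in>{1..<card B}. ?f ((\<omega> ^^ d) b) b)"
      using sum.reindex_bij_betw[OF bij_betw_funpow_orbit[OF assms(1,2), of b], of "\<lambda>a. ?f a b"]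
          BD(5)[OF B(2)] by simp
    also have "\<dots> = (\<Sum>d\<in>{1..<card B}. cycle_wt (d - 1) * cycle_wt (card B - s - (d - 1))
        * cycle_prod card (?\<C> - {B}))"
    proof (rule sum.cong[OF refl])
      fix d assume d: "d \<in> {1..<card B}"
      have "(\<omega> ^^ d) b \<in> orbit \<omega> b - {b}"
        using bij_betw_apply[OF bij_betw_funpow_orbit[OF assms(1,2), of b], of d] d BD(5)[OF B(2)]
            by simp
      then have "(\<omega> ^^ d) b \<noteq> b" by simp
      then show "?f ((\<omega> ^^ d) b) b = cycle_wt (d - 1) * cycle_wt (card B - s - (d - 1))
          * cycle_prod card (?\<C> - {B})"
        using deletion_wt_cut[OF assms(1,2) B, of d] d D[of "(\<omega> ^^ d) b" b] by auto
    qed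
    also have "\<dots> = (\<Sum>e<card B - 1. cycle_wt e * cycle_wt (card B - s - e)
        * cycle_prod card (?\<C> - {B}))"
      by (rule sum.reindex_bij_witness[of _ Suc "\<lambda>d. d - 1"]) auto
    finally show ?thesis by (simp only: sum_distrib_right)
  qed
  have "(\<Sum>b\<in>S. \<Sum>a\<in>S-{b}. ?f a b) = (\<Sum>B\<in>?\<C>. \<Sum>b\<in>B. \<Sum>a\<in>S-{b}. ?f a b)"
    by (rule sum_over_cycles[OF assms(1,2)])
  also have "\<dots> = (\<Sum>B\<in>?\<C>. of_nat (card B) *
      ((\<Sum>A\<in>?\<C>-{B}. of_nat (card A) * cycle_wt (card B + card A - s)
      * cycle_prod card (?\<C> - {B} - {A}))
     + (\<Sum>e<card B - 1. cycle_wt e * cycle_wt (card B - s - e)) * cycle_prod card (?\<C> - {B})))"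
    by (intro sum.cong refl) (simp add: inner)
  also have "\<dots> = cut_join s card ?\<C>"
    by (simp add: cut_join_def distrib_left sum.distrib sum_distrib_left sum_distrib_right
        mult.assoc)
  finally show ?thesis .
qed

subsection \<open>Averaging over conjugacy classes\<close>

lemma cycles_on_conj:
  assumes "finite S" "g permutes S" "\<pi> permutes S"
  shows "cycles_on S (g \<circ> \<pi> \<circ> inv g) = image g ` cycles_on S \<pi>"
proof -
  have "orbit (g \<circ> \<pi> \<circ> inv g) (g x) = g ` orbit \<pi> x" for x
    using orbit_inverse[of x \<pi> "g \<circ> \<pi> \<circ> inv g" g] self_in_orbit[OF assms(1,3), of x]
        permutes_inverses(2)[OF assms(2)]
    by auto
  then have "image g ` cycles_on S \<pi> = orbit (g \<circ> \<pi> \<circ> inv g) ` g ` S"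
    by (simp add: cycles_on_def image_image)
  then show ?thesis using permutes_image[OF assms(2)] by (simp add: cycles_on_def)
qed

lemma inj_image: "inj g \<Longrightarrow> inj_on (image g) Y"
  by (simp add: inj_image_eq_iff inj_on_def)

lemma card_cycles_conj:
  assumes "finite S" "g permutes S" "\<pi> permutes S"
  shows "card (cycles_on S (g \<circ> \<pi> \<circ> inv g)) = card (cycles_on S \<pi>)"
  unfolding cycles_on_conj[OF assms] by (intro card_image inj_image permutes_inj[OF assms(2)])

lemma cycle_type_conj:
  assumes "finite S" "g permutes S" "\<pi> permutes S"
  shows "image_mset card (mset_set (cycles_on S (g \<circ> \<pi> \<circ> inv g)))
      = image_mset card (mset_set (cycles_on S \<pi>))"
proof -
  note g = permutes_inj[OF assms(2)]
  have "mset_set (cycles_on S (g \<circ> \<pi> \<circ> inv g)) = image_mset (image g) (mset_set (cycles_on S \<pi>))"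
    unfolding cycles_on_conj[OF assms] by (rule image_mset_mset_set[symmetric])
        (rule inj_image[OF g])
  moreover have "card (g ` C) = card C" for C using inj_on_subset[OF g] card_image by blast
  ultimately show ?thesis by (simp add: image_mset.compositionality comp_def)
qed

lemma deletion_wt_conj:
  assumes "finite S" "g permutes S" "\<pi> permutes S"
  shows "deletion_wt (g ` D) S (g \<circ> \<pi> \<circ> inv g) = deletion_wt D S \<pi>"
proof -
  note g = permutes_inj[OF assms(2)]
  have "card (g ` C - g ` D) = card (C - D)" for C
    using inj_on_subset[OF g] card_image by (metis image_set_diff[OF g] subset_UNIV)
  then show ?thesis
    unfolding deletion_wt_def cycles_on_conj[OF assms] by (simp add: prod.reindex inj_image[OF g])
qed

lemma transpose_conj: "bij g \<Longrightarrow> transpose (g a) (g b) \<circ> g = g \<circ> transpose a b"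
  by (simp add: transpose_comp_eq inv_f_f bij_is_inj)

text \<open>The conjugators range over \<open>T\<close>, which may be smaller than \<open>S\<close>:
  in the applications \<open>T\<close> consists of the points that are not deleted.\<close>

definition conj_invariant :: "'a set \<Rightarrow> 'a set \<Rightarrow> (('a \<Rightarrow> 'a) \<Rightarrow> 'b) \<Rightarrow> bool" where
  "conj_invariant T S \<phi> \<longleftrightarrow> (\<forall>g \<pi>. g permutes T \<longrightarrow> \<pi> permutes S \<longrightarrow> \<phi> (g \<circ> \<pi> \<circ> inv g) = \<phi> \<pi>)"

lemma conj_invariantD:
  "conj_invariant T S \<phi> \<Longrightarrow> g permutes T \<Longrightarrow> \<pi> permutes S \<Longrightarrow> \<phi> (g \<circ> \<pi> \<circ> inv g) = \<phi> \<pi>"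
  by (auto simp: conj_invariant_def)

lemma sum_permutations_conj:
  assumes "g permutes S"
  shows "(\<Sum>\<omega> | \<omega> permutes S. f (g \<circ> \<omega> \<circ> inv g)) = (\<Sum>\<omega> | \<omega> permutes S. f \<omega>)"
proof -
  have "(\<Sum>\<omega> | \<omega> permutes S. f (g \<circ> \<omega> \<circ> inv g)) = (\<Sum>\<omega> | \<omega> permutes S. f (g \<circ> \<omega>))"
    using sum_permutations_compose_right[OF permutes_inv[OF assms], of "\<lambda>\<omega>. f (g \<circ> \<omega>)"]
        by (simp add: comp_assoc)
  also have "\<dots> = (\<Sum>\<omega> | \<omega> permutes S. f \<omega>)"
    using setum_permutations_compose_left[OF assms, of f] by simp
  finally show ?thesis .
qed

text \<open>Class functions instead of conjugacy classes: the identity stays linear in \<open>\<phi>\<close> and needs no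
  division by the size of a class.\<close>
definition long_cycle_formula :: "'a set \<Rightarrow> bool" where
  "long_cycle_formula S \<longleftrightarrow> (\<forall>c \<phi>. c permutes S \<longrightarrow> cyclic_on c S \<longrightarrow> conj_invariant S S \<phi> \<longrightarrow>
     (\<Sum>\<pi> | \<pi> permutes S. \<phi> \<pi> * poly_x ^ card (cycles_on S (c \<circ> \<pi>)))
   = (\<Sum>\<pi> | \<pi> permutes S. \<phi> \<pi> * (binomial_series poly_x * cycle_prod card (cycles_on S \<pi>)) $
       (card S + 1)))"

lemma long_cycle_formulaD:
  assumes "long_cycle_formula S" "c permutes S" "cyclic_on c S" "conj_invariant S S \<phi>"
  shows "(\<Sum>\<pi> | \<pi> permutes S. \<phi> \<pi> * poly_x ^ card (cycles_on S (c \<circ> \<pi>)))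
   = (\<Sum>\<pi> | \<pi> permutes S. \<phi> \<pi> * (binomial_series poly_x * cycle_prod card (cycles_on S \<pi>)) $
       (card S + 1))"
  using assms unfolding long_cycle_formula_def by blast

section \<open>The formula for long cycles\<close>

lemma deletion_wt_empty:
  assumes "finite S" "\<pi> permutes S"
  shows "deletion_wt {} S \<pi> = cycle_prod card (cycles_on S \<pi>)"
  unfolding deletion_wt_def cycle_prod_def
  using cycles_onD(4)[OF assms] by (intro prod.cong refl) (auto simp: cycle_wt_def)

text \<open>Every permutation of \<open>insert b T\<close> is
  \<open>transpose b e \<circ> \<sigma>\<close> for exactly one e and one \<sigma>. Summing over e
  absorbs b into the coefficient function, and since the number of cycles and
  \<open>deletion_wt\<close> react to b alike, the same \<Psi> serves both sides. The index stays at
  \<open>card S + 1\<close>, as deleted points do not count.\<close>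

lemma long_cycle_sum_with_deletions:
  assumes "finite D" "finite S" "S \<inter> D = {}" "long_cycle_formula S" "c permutes S" "cyclic_on c S"
    and "conj_invariant S (S \<union> D) \<Theta>"
  shows "(\<Sum>\<sigma> | \<sigma> permutes (S \<union> D). \<Theta> \<sigma> * poly_x ^ card (cycles_on (S \<union> D) (c \<circ> \<sigma>)))
   = (\<Sum>\<sigma> | \<sigma> permutes (S \<union> D). \<Theta> \<sigma> * (binomial_series poly_x * deletion_wt D (S \<union> D) \<sigma>) $
       (card S + 1))"
  using assms(1,3,7)
proof (induction D arbitrary: \<Theta> rule: finite_induct)
  case empty
  then have "conj_invariant S S \<Theta>" by simp
  show ?case
    unfolding Un_empty_right long_cycle_formulaD[OF assms(4-6) \<open>conj_invariant S S \<Theta>\<close>]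
    by (intro sum.cong refl) (simp add: deletion_wt_empty[OF assms(2)])
next
  case (insert b D)
  define T where "T = S \<union> D"
  \<comment> \<open>The factor x records the cycle that is lost when b is deleted as a fixed
    point.\<close>
  define \<Psi> where "\<Psi> \<sigma> = (\<Sum>e\<in>insert b T. \<Theta> (transpose b e \<circ> \<sigma>) * (if e = b then poly_x else 1))"
      for \<sigma>
  have T: "finite T" "b \<notin> T" "S \<union> insert b D = insert b T" "S \<subseteq> T"
    using insert assms(2) by (auto simp: T_def)
  have cT: "c permutes T" using assms(5) T(4) by (rule permutes_subset)
  have cb: "c b = b" "inv c b = b" using permutes_not_in[OF cT T(2)]
      permutes_not_in[OF permutes_inv[OF cT] T(2)] by auto
  \<comment> \<open>Reindexing the sum by e to g e respects the case e = b, because g fixes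
    b.\<close>
  have inv: "conj_invariant S T \<Psi>"
    unfolding conj_invariant_def
  proof (intro allI impI)
    fix g \<sigma> assume g: "g permutes S" and \<sigma>: "\<sigma> permutes T"
    have gT: "g permutes T" using g T(4) by (rule permutes_subset)
    have gbT: "g permutes insert b T" using gT by (rule permutes_imp_permutes_insert)
    have gb: "g b = b" using permutes_not_in[OF gT T(2)] .
    have \<sigma>': "\<sigma> permutes insert b T" using \<sigma> by (rule permutes_imp_permutes_insert)
    have "\<Psi> (g \<circ> \<sigma> \<circ> inv g) = (\<Sum>e\<in>insert b T. \<Theta> (transpose b (g e) \<circ> (g \<circ> \<sigma> \<circ> inv g))
        * (if g e = b then poly_x else 1))"
      unfolding \<Psi>_def by (rule sum.reindex_bij_betw[OF permutes_imp_bij[OF gbT], symmetric])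
    also have "\<dots> = \<Psi> \<sigma>"
      unfolding \<Psi>_def
    proof (rule sum.cong[OF refl])
      fix e assume e: "e \<in> insert b T"
      have "transpose b (g e) \<circ> (g \<circ> \<sigma> \<circ> inv g) = g \<circ> (transpose b e \<circ> \<sigma>) \<circ> inv g"
        using transpose_conj[OF permutes_bij[OF gT], of b e] by (simp add: gb comp_assoc[symmetric])
      moreover have "\<Theta> (g \<circ> (transpose b e \<circ> \<sigma>) \<circ> inv g) = \<Theta> (transpose b e \<circ> \<sigma>)"
        using insert.prems(2) e g \<sigma>' unfolding T(3)
        by (intro conj_invariantD permutes_compose permutes_swap_id) auto
      moreover have "g e = b \<longleftrightarrow> e = b" using gb permutes_inj[OF gT] by (metis injD)
      ultimately show "\<Theta> (transpose b (g e) \<circ> (g \<circ> \<sigma> \<circ> inv g)) * (if g e = b then poly_x else 1)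
         = \<Theta> (transpose b e \<circ> \<sigma>) * (if e = b then poly_x else 1)" by simp
    qed
    finally show "\<Psi> (g \<circ> \<sigma> \<circ> inv g) = \<Psi> \<sigma>" .
  qed
  have "(\<Sum>\<sigma> | \<sigma> permutes insert b T. \<Theta> \<sigma> * poly_x ^ card (cycles_on (insert b T) (c \<circ> \<sigma>)))
    = (\<Sum>e\<in>insert b T. \<Sum>\<sigma> | \<sigma> permutes T. \<Theta> (transpose b e \<circ> \<sigma>)
        * poly_x ^ card (cycles_on (insert b T) (c \<circ> (transpose b e \<circ> \<sigma>))))"
    by (rule sum_over_permutations_insert[OF T(1,2)])
  also have "\<dots> = (\<Sum>e\<in>insert b T. \<Sum>\<sigma> | \<sigma> permutes T. \<Theta> (transpose b e \<circ> \<sigma>)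
      * (if e = b then poly_x else 1) * poly_x ^ card (cycles_on T (c \<circ> \<sigma>)))"
  proof (intro sum.cong refl)
    fix e \<sigma> assume e: "e \<in> insert b T" and \<sigma>: "\<sigma> \<in> {\<sigma>. \<sigma> permutes T}"
    \<comment> \<open>Since c fixes b, the transposition passes through c and becomes an insertion
      of b in front of c e.\<close>
    have "c \<circ> (transpose b e \<circ> \<sigma>) = transpose b (c e) \<circ> (c \<circ> \<sigma>)"
      using transpose_conj[OF permutes_bij[OF cT], of b e] by (simp add: cb comp_assoc[symmetric])
    moreover have "c e \<in> insert b T" using e cb permutes_in_image[OF cT] by auto
    moreover have "c \<circ> \<sigma> permutes T" using \<sigma> cT by (auto intro: permutes_compose)
    moreover have "c e = b \<longleftrightarrow> e = b" using cb permutes_inj[OF cT] by (metis injD)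
    ultimately show "\<Theta> (transpose b e \<circ> \<sigma>)
        * poly_x ^ card (cycles_on (insert b T) (c \<circ> (transpose b e \<circ> \<sigma>)))
       = \<Theta> (transpose b e \<circ> \<sigma>) * (if e = b then poly_x else 1)
           * poly_x ^ card (cycles_on T (c \<circ> \<sigma>))"
      using card_cycles_insert[OF T(1) _ T(2), of "c \<circ> \<sigma>" "c e"] by (simp only:) simp
  qed
  also have "\<dots> = (\<Sum>\<sigma> | \<sigma> permutes T. \<Psi> \<sigma> * poly_x ^ card (cycles_on T (c \<circ> \<sigma>)))"
    unfolding \<Psi>_def sum_distrib_right by (rule sum.swap)
  also have "\<dots> = (\<Sum>\<sigma> | \<sigma> permutes T. \<Psi> \<sigma> * (binomial_series poly_x * deletion_wt D T \<sigma>) $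
      (card S + 1))"
    unfolding T_def using insert.prems(1) by (intro insert.IH inv[unfolded T_def]) auto
  also have "\<dots> = (\<Sum>e\<in>insert b T. \<Sum>\<sigma> | \<sigma> permutes T. \<Theta> (transpose b e \<circ> \<sigma>)
      * (if e = b then poly_x else 1) * (binomial_series poly_x * deletion_wt D T \<sigma>) $
      (card S + 1))"
    unfolding \<Psi>_def sum_distrib_right by (rule sum.swap)
  also have "\<dots> = (\<Sum>e\<in>insert b T. \<Sum>\<sigma> | \<sigma> permutes T. \<Theta> (transpose b e \<circ> \<sigma>)
      * (binomial_series poly_x * deletion_wt (insert b D) (insert b T) (transpose b e \<circ> \<sigma>)) $
      (card S + 1))"
  proof (intro sum.cong refl)
    fix e \<sigma> assume e: "e \<in> insert b T" and \<sigma>: "\<sigma> \<in> {\<sigma>. \<sigma> permutes T}"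
    have "(binomial_series poly_x * (x_fps * deletion_wt D T \<sigma>)) $ (card S + 1)
        = poly_x * (binomial_series poly_x * deletion_wt D T \<sigma>) $ (card S + 1)"
      by (simp only: mult.left_commute[of "binomial_series poly_x" x_fps] fps_mult_left_const_nth)
    then show "\<Theta> (transpose b e \<circ> \<sigma>) * (if e = b then poly_x else 1)
        * (binomial_series poly_x * deletion_wt D T \<sigma>) $ (card S + 1)
       = \<Theta> (transpose b e \<circ> \<sigma>) * (binomial_series poly_x
           * deletion_wt (insert b D) (insert b T) (transpose b e \<circ> \<sigma>)) $ (card S + 1)"
      using deletion_wt_insert[OF T(1) _ T(2) e, of \<sigma> D] \<sigma> by simp
  qed
  also have "\<dots> = (\<Sum>\<sigma> | \<sigma> permutes insert b T. \<Theta> \<sigma>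
      * (binomial_series poly_x * deletion_wt (insert b D) (insert b T) \<sigma>) $ (card S + 1))"
    by (rule sum_over_permutations_insert[OF T(1,2), symmetric])
  finally show ?case unfolding T(3) .
qed

text \<open>Conjugating by powers of \<open>c\<close> moves the transposed point \<open>a\<close> around the cycle.\<close>
lemma long_cycle_sum_transpose:
  assumes "finite S" "b \<in> S" "c permutes S - {b}" "cyclic_on c (S - {b})" "conj_invariant S S \<phi>"
    and "a \<in> S - {b}" "a' \<in> S - {b}"
  shows "(\<Sum>\<omega> | \<omega> permutes S. \<phi> \<omega> * poly_x ^ card (cycles_on S (c \<circ> transpose a b \<circ> \<omega>)))
       = (\<Sum>\<omega> | \<omega> permutes S. \<phi> \<omega> * poly_x ^ card (cycles_on S (c \<circ> transpose a' b \<circ> \<omega>)))"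
proof -
  have cS: "c permutes S" using assms(3) by (rule permutes_subset) auto
  have "a' \<in> orbit c a" using assms(4,6,7) unfolding cyclic_on_alldef by auto
  then obtain k where k: "a' = (c ^^ k) a" by (auto simp: orbit_altdef)
  define g where "g = c ^^ k"
  have gS: "g permutes S - {b}" unfolding g_def
      by (induction k) (simp_all only: funpow.simps permutes_id permutes_compose assms(3))
  then have gb: "g b = b" by (auto intro: permutes_not_in)
  have g: "g permutes S" using gS by (rule permutes_subset) auto
  have comm: "g \<circ> c = c \<circ> g" unfolding g_def by (simp add: fun_eq_iff funpow_swap1)
  have conj: "g \<circ> (c \<circ> transpose a b \<circ> \<omega>) \<circ> inv g = c \<circ> transpose a' b \<circ> (g \<circ> \<omega> \<circ> inv g)" for \<omega>
  proof -
    have "g \<circ> (c \<circ> transpose a b \<circ> \<omega>) \<circ> inv g = (g \<circ> c) \<circ> transpose a b \<circ> \<omega> \<circ> inv g"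
      by (simp only: comp_assoc)
    also have "\<dots> = c \<circ> (g \<circ> transpose a b) \<circ> \<omega> \<circ> inv g" unfolding comm by (simp only: comp_assoc)
    also have "g \<circ> transpose a b = transpose a' b \<circ> g"
      using transpose_conj[OF permutes_bij[OF g], of a b]
      unfolding gb k[folded g_def, symmetric] by simp
    finally show ?thesis by (simp only: comp_assoc)
  qed
  have "(\<Sum>\<omega> | \<omega> permutes S. \<phi> \<omega> * poly_x ^ card (cycles_on S (c \<circ> transpose a b \<circ> \<omega>)))
     = (\<Sum>\<omega> | \<omega> permutes S. \<phi> (g \<circ> \<omega> \<circ> inv g)
         * poly_x ^ card (cycles_on S (c \<circ> transpose a' b \<circ> (g \<circ> \<omega> \<circ> inv g))))"
  proof (intro sum.cong refl)
    fix \<omega> assume "\<omega> \<in> {\<omega>. \<omega> permutes S}"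
    then have \<omega>: "\<omega> permutes S" by simp
    have "c \<circ> transpose a b \<circ> \<omega> permutes S"
      using assms(2,6) by (intro permutes_compose \<omega> cS permutes_swap_id) auto
    then show "\<phi> \<omega> * poly_x ^ card (cycles_on S (c \<circ> transpose a b \<circ> \<omega>))
      = \<phi> (g \<circ> \<omega> \<circ> inv g) * poly_x ^ card (cycles_on S (c \<circ> transpose a' b \<circ> (g \<circ> \<omega> \<circ> inv g)))"
      unfolding conj[symmetric] using card_cycles_conj[OF assms(1) g]
          conj_invariantD[OF assms(5) g \<omega>] by simp
  qed
  also have "\<dots> = (\<Sum>\<omega> | \<omega> permutes S. \<phi> \<omega> * poly_x ^ card (cycles_on S (c \<circ> transpose a' b \<circ> \<omega>)))"
    by (rule sum_permutations_conj[OF g])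
  finally show ?thesis .
qed

text \<open>Here a is the predecessor of b, so c' sends b to c a = b. Read backwards, c is c' with b
  inserted in front of c' a; as c has the single cycle \<open>S\<close>, the orbit of c' a must be
  all of \<open>S - {b}\<close>.\<close>

lemma long_cycle_remove_point:
  assumes "finite S" "c permutes S" "cyclic_on c S" "b \<in> S" "card S \<ge> 2"
  obtains a c' where "a \<in> S - {b}" "c' permutes S - {b}" "cyclic_on c' (S - {b})" "c
      = c' \<circ> transpose a b"
proof -
  define a where "a = inv c b"
  define c' where "c' = c \<circ> transpose a b"
  have ca: "c a = b" by (simp add: a_def permutes_inverses[OF assms(2)])
  have cb: "c b \<noteq> b" using eq_on_cyclic_on_iff1[OF assms(3,4)] assms(5) by fastforce
  then have ab: "a \<noteq> b" using ca by auto
  have aS: "a \<in> S" using ca assms(4) permutes_in_image[OF assms(2)] by metis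
  have c'S: "c' permutes S" unfolding c'_def by (intro permutes_compose assms permutes_swap_id aS)
  have c'b: "c' b = b" by (simp add: c'_def ca)
  have c': "c' permutes S - {b}" using c'S by (rule permutes_superset) (auto simp: c'b)
  have c: "c = c' \<circ> transpose a b" by (simp add: c'_def fun_eq_iff)
  have c'a: "c' a \<in> S - {b}" using permutes_in_image[OF c'] aS ab by auto
  have "c = transpose b (c' a) \<circ> c'"
    using transpose_conj[OF permutes_bij[OF c'S], of a b] by (simp add: c c'b transpose_commute)
  then have "cycles_on S c = insert (insert b (orbit c' (c' a)))
      (cycles_on (S - {b}) c' - {orbit c' (c' a)})"
    using cycles_on_insert_point[of "S - {b}" c' b "c' a"] c' c'a assms(1,4)
        by (simp add: insert_absorb)
  then have "insert b (orbit c' (c' a)) \<in> cycles_on S c" by simp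
  moreover have "cycles_on S c = {S}" using assms(3) unfolding cyclic_on_alldef cycles_on_def
      by auto
  ultimately have "S = insert b (orbit c' (c' a))" by simp
  moreover have "orbit c' (c' a) \<subseteq> S - {b}" using permutes_orbit_subset[OF c' c'a] .
  ultimately have "S - {b} = orbit c' (c' a)" by blast
  then have "cyclic_on c' (S - {b})" using c'a unfolding cyclic_on_def by blast
  then show ?thesis using that[of a c'] aS ab c' c by auto
qed

text \<open>For fixed b the left side is the same for every a, so n - 1 copies of it form a sum over
  a. Summing over b as well produces \<open>cut_join 1\<close> on the right, and
  \<open>cut_join_1_coeff\<close> returns the same factor n (n - 1), which cancels.\<close>

lemma long_cycle_formula_step:
  assumes "finite S" "card S \<ge> 2" "\<And>b. b \<in> S \<Longrightarrow> long_cycle_formula (S - {b})"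
  shows "long_cycle_formula S"
  unfolding long_cycle_formula_def
proof (intro allI impI)
  fix c and \<phi> :: "('a \<Rightarrow> 'a) \<Rightarrow> rat poly"
  assume c: "c permutes S" "cyclic_on c S" and \<phi>: "conj_invariant S S \<phi>"
  define n where "n = card S"
  define Z where "Z = binomial_series poly_x"
  let ?L = "\<Sum>\<pi> | \<pi> permutes S. \<phi> \<pi> * poly_x ^ card (cycles_on S (c \<circ> \<pi>))"
  have one: "of_nat (n - 1) * ?L = (\<Sum>\<omega> | \<omega> permutes S. \<phi> \<omega>
      * (\<Sum>a\<in>S-{b}. (Z * deletion_wt {b} S (transpose a b \<circ> \<omega>)) $ n))"
    if b: "b \<in> S" for b
  proof -
    obtain a c' where a: "a \<in> S - {b}" and c': "c' permutes S - {b}" "cyclic_on c' (S - {b})" "c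
        = c' \<circ> transpose a b"
      using long_cycle_remove_point[OF assms(1) c b assms(2)] by blast
    \<comment> \<open>The sum over a is needed for invariance: a conjugator that fixes b may move a,
      and then only permutes the summands.\<close>
    define \<Theta> where "\<Theta> \<sigma> = (\<Sum>a\<in>S-{b}. \<phi> (transpose a b \<circ> \<sigma>))" for \<sigma>
    have Sb: "S - {b} \<union> {b} = S" using b by auto
    have inv: "conj_invariant (S - {b}) (S - {b} \<union> {b}) \<Theta>"
      unfolding conj_invariant_def Sb
    proof (intro allI impI)
      fix g \<sigma> assume g: "g permutes S - {b}" and \<sigma>: "\<sigma> permutes S"
      have gS: "g permutes S" using g by (rule permutes_subset) auto
      have gb: "g b = b" using g by (auto intro: permutes_not_in)
      have "\<Theta> (g \<circ> \<sigma> \<circ> inv g) = (\<Sum>a\<in>S-{b}. \<phi> (transpose (g a) b \<circ> (g \<circ> \<sigma> \<circ> inv g)))"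
        unfolding \<Theta>_def by (rule sum.reindex_bij_betw[OF permutes_imp_bij[OF g], symmetric])
      also have "\<dots> = \<Theta> \<sigma>"
        unfolding \<Theta>_def
      proof (rule sum.cong[OF refl])
        fix a assume "a \<in> S - {b}"
        then have "transpose a b \<circ> \<sigma> permutes S" using b
            by (intro permutes_compose \<sigma> permutes_swap_id) auto
        moreover have "transpose (g a) b \<circ> (g \<circ> \<sigma> \<circ> inv g) = g \<circ> (transpose a b \<circ> \<sigma>) \<circ> inv g"
          using transpose_conj[OF permutes_bij[OF gS], of a b]
              by (simp add: gb comp_assoc[symmetric])
        ultimately show "\<phi> (transpose (g a) b \<circ> (g \<circ> \<sigma> \<circ> inv g)) = \<phi> (transpose a b \<circ> \<sigma>)"
          using conj_invariantD[OF \<phi> gS] by metis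
      qed
      finally show "\<Theta> (g \<circ> \<sigma> \<circ> inv g) = \<Theta> \<sigma>" .
    qed
    have compose: "(\<Sum>\<omega> | \<omega> permutes S. f \<omega>) = (\<Sum>\<sigma> | \<sigma> permutes S. f (transpose a b \<circ> \<sigma>))"
        if "a \<in> S" for a and f :: "_ \<Rightarrow> rat poly"
      using setum_permutations_compose_left[OF permutes_swap_id[OF that b]] .
    have "of_nat (n - 1) * ?L = (\<Sum>a'\<in>S-{b}. ?L)"
      using assms(1) b by (simp add: n_def)
    also have "\<dots> = (\<Sum>a'\<in>S-{b}. \<Sum>\<omega> | \<omega> permutes S. \<phi> \<omega>
        * poly_x ^ card (cycles_on S (c' \<circ> transpose a' b \<circ> \<omega>)))"
      unfolding c'(3) by (intro sum.cong refl long_cycle_sum_transpose[OF assms(1) b c'(1,2) \<phi> a])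
    also have "\<dots> = (\<Sum>a'\<in>S-{b}. \<Sum>\<sigma> | \<sigma> permutes S. \<phi> (transpose a' b \<circ> \<sigma>)
        * poly_x ^ card (cycles_on S (c' \<circ> \<sigma>)))"
    proof (rule sum.cong[OF refl])
      fix a' assume "a' \<in> S - {b}"
      then have a': "a' \<in> S" by simp
      have cancel: "c' \<circ> transpose a' b \<circ> (transpose a' b \<circ> \<sigma>) = c' \<circ> \<sigma>" for \<sigma> :: "'a \<Rightarrow> 'a"
        by (simp add: fun_eq_iff)
      show "(\<Sum>\<omega> | \<omega> permutes S. \<phi> \<omega> * poly_x ^ card (cycles_on S (c' \<circ> transpose a' b \<circ> \<omega>)))
        = (\<Sum>\<sigma> | \<sigma> permutes S. \<phi> (transpose a' b \<circ> \<sigma>) * poly_x ^ card (cycles_on S (c' \<circ> \<sigma>)))"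
        using compose[OF a', of "\<lambda>\<omega>. \<phi> \<omega> * poly_x ^ card (cycles_on S (c' \<circ> transpose a' b \<circ> \<omega>))"]
        by (simp only: cancel)
    qed
    also have "\<dots> = (\<Sum>\<sigma> | \<sigma> permutes S. \<Theta> \<sigma> * poly_x ^ card (cycles_on S (c' \<circ> \<sigma>)))"
      unfolding \<Theta>_def sum_distrib_right by (rule sum.swap)
    also have "\<dots> = (\<Sum>\<sigma> | \<sigma> permutes S. \<Theta> \<sigma> * (Z * deletion_wt {b} S \<sigma>) $ n)"
      using long_cycle_sum_with_deletions[OF _ _ _ assms(3)[OF b] c'(1,2) inv] assms(1,2) b
      unfolding Sb n_def Z_def by simp
    also have "\<dots> = (\<Sum>a'\<in>S-{b}. \<Sum>\<sigma> | \<sigma> permutes S. \<phi> (transpose a' b \<circ> \<sigma>)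
        * (Z * deletion_wt {b} S \<sigma>) $ n)"
      unfolding \<Theta>_def sum_distrib_right by (rule sum.swap)
    also have "\<dots> = (\<Sum>a'\<in>S-{b}. \<Sum>\<omega> | \<omega> permutes S. \<phi> \<omega>
        * (Z * deletion_wt {b} S (transpose a' b \<circ> \<omega>)) $ n)"
    proof (rule sum.cong[OF refl])
      fix a' assume "a' \<in> S - {b}"
      then have a': "a' \<in> S" by simp
      have cancel: "transpose a' b \<circ> (transpose a' b \<circ> \<sigma>) = \<sigma>" for \<sigma> :: "'a \<Rightarrow> 'a"
        by (simp add: fun_eq_iff)
      show "(\<Sum>\<sigma> | \<sigma> permutes S. \<phi> (transpose a' b \<circ> \<sigma>) * (Z * deletion_wt {b} S \<sigma>) $ n)
        = (\<Sum>\<omega> | \<omega> permutes S. \<phi> \<omega> * (Z * deletion_wt {b} S (transpose a' b \<circ> \<omega>)) $ n)"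
        using compose[OF a', of "\<lambda>\<omega>. \<phi> \<omega> * (Z * deletion_wt {b} S (transpose a' b \<circ> \<omega>)) $ n"]
        by (simp only: cancel)
    qed
    finally show ?thesis unfolding sum_distrib_left by (subst (asm) sum.swap)
  qed
  have "of_nat n * (of_nat (n - 1) * ?L) = (\<Sum>b\<in>S. of_nat (n - 1) * ?L)"
    by (simp add: n_def)
  also have "\<dots> = (\<Sum>b\<in>S. \<Sum>\<omega> | \<omega> permutes S. \<phi> \<omega>
      * (\<Sum>a\<in>S-{b}. (Z * deletion_wt {b} S (transpose a b \<circ> \<omega>)) $ n))"
    by (intro sum.cong refl one)
  also have "\<dots> = (\<Sum>\<omega> | \<omega> permutes S. \<phi> \<omega> *
      (Z * (\<Sum>b\<in>S. \<Sum>a\<in>S-{b}. deletion_wt {b} S (transpose a b \<circ> \<omega>))) $ n)"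
    by (subst sum.swap) (simp add: sum_distrib_left fps_sum_nth)
  also have "\<dots> = (\<Sum>\<omega> | \<omega> permutes S. \<phi> \<omega> *
      (of_nat n * (of_nat n - 1) * (Z * cycle_prod card (cycles_on S \<omega>)) $ (n + 1)))"
  proof (intro sum.cong refl)
    fix \<omega> assume "\<omega> \<in> {\<omega>. \<omega> permutes S}"
    then have \<omega>: "\<omega> permutes S" by simp
    have "(\<Sum>b\<in>S. \<Sum>a\<in>S-{b}. deletion_wt {b} S (transpose a b \<circ> \<omega>)) = cut_join 1 card (cycles_on S \<omega>)"
      by (rule sum_deletion_wt[OF assms(1) \<omega>]) auto
    moreover have "(Z * cut_join 1 card (cycles_on S \<omega>)) $ n
       = of_nat n * (of_nat n - 1) * (Z * cycle_prod card (cycles_on S \<omega>)) $ (n + 1)"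
      using cut_join_1_coeff[of "cycles_on S \<omega>" card, OF finite_cycles_on[OF assms(1)]
          cycles_onD(4)[OF assms(1) \<omega>]]
      unfolding sum_card_cycles[OF assms(1) \<omega>] n_def Z_def .
    ultimately show "\<phi> \<omega> * (Z * (\<Sum>b\<in>S. \<Sum>a\<in>S-{b}. deletion_wt {b} S (transpose a b \<circ> \<omega>))) $ n
      = \<phi> \<omega> * (of_nat n * (of_nat n - 1) * (Z * cycle_prod card (cycles_on S \<omega>)) $ (n + 1))"
      by (simp only:)
  qed
  also have "\<dots> = of_nat n * (of_nat (n - 1)
      * (\<Sum>\<omega> | \<omega> permutes S. \<phi> \<omega> * (Z * cycle_prod card (cycles_on S \<omega>)) $ (n + 1)))"
    using assms(2) by (simp add: sum_distrib_left n_def mult_ac)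
  finally have "of_nat (n * (n - 1)) * ?L
      = of_nat (n * (n - 1)) * (\<Sum>\<omega> | \<omega> permutes S. \<phi> \<omega>
      * (Z * cycle_prod card (cycles_on S \<omega>)) $ (n + 1))"
    by (simp only: of_nat_mult mult.assoc)
  moreover have "of_nat (n * (n - 1)) \<noteq> (0 :: rat poly)"
    using assms(2) unfolding of_nat_eq_0_iff by (simp add: n_def)
  ultimately have "?L = (\<Sum>\<omega> | \<omega> permutes S. \<phi> \<omega> * (Z * cycle_prod card (cycles_on S \<omega>)) $ (n + 1))"
    using mult_left_cancel by blast
  then show "?L = (\<Sum>\<pi> | \<pi> permutes S. \<phi> \<pi>
      * (binomial_series poly_x * cycle_prod card (cycles_on S \<pi>)) $ (card S + 1))"
    unfolding n_def Z_def .
qed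

theorem long_cycle_formula:
  assumes "finite S" "S \<noteq> {}"
  shows "long_cycle_formula S"
  using assms
proof (induction "card S" arbitrary: S rule: less_induct)
  case less
  show ?case
  proof (cases "card S \<ge> 2")
    case True
    show ?thesis
    proof (rule long_cycle_formula_step[OF less.prems(1) True])
      fix b assume b: "b \<in> S"
      have "card (S - {b}) = card S - 1" using b less.prems by simp
      then have "card (S - {b}) > 0" "card (S - {b}) < card S" using True by auto
      moreover from this have "S - {b} \<noteq> {}" by (metis card.empty less_irrefl)
      ultimately show "long_cycle_formula (S - {b})" using less by blast
    qed
  next
    case False
    moreover have "card S > 0" using less.prems by (simp add: card_gt_0_iff)
    ultimately have "card S = 1" by simp
    then obtain s where s: "S = {s}" by (auto simp: card_1_singleton_iff)
    have cyc: "cycles_on {s} id = {{s}}" by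
        (simp add: cycles_on_def orbit_eq_singleton_iff[THEN iffD2])
    \<comment> \<open>The single cycle contributes the factor y, so this is the linear coefficient
      of (1+y)^x.\<close>
    have coeff: "(binomial_series poly_x * cycle_prod card {{s}}) $ Suc (Suc 0) = poly_x"
      by (simp add: cycle_prod_def binomial_series_def poly_binomial_def)
    have perms: "{\<pi>. \<pi> permutes {s}} = {id}" by auto
    have "c = id" if "c permutes {s}" for c using that perms by blast
    then show ?thesis
      unfolding long_cycle_formula_def s perms by (simp add: cyc coeff)
  qed
qed

subsection \<open>Cycle type $[2,n-2]$\<close>

text \<open>Ensures that the class of \<beta> is nonempty, so that the division in
  \<open>P_poly\<close> is genuine. The new point becomes a fixed point if the chosen part is 1, and
  otherwise lengthens a cycle of size k - 1.\<close>

lemma exists_permutation_of_type: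
  assumes "finite S" "sum_mset \<beta> = card S" "\<And>k. k \<in># \<beta> \<Longrightarrow> k \<ge> 1"
  shows "\<exists>\<pi>. \<pi> permutes S \<and> image_mset card (mset_set (cycles_on S \<pi>)) = \<beta>"
  using assms
proof (induction S arbitrary: \<beta> rule: finite_induct)
  case empty
  have "\<beta> = {#}"
  proof (rule ccontr)
    assume "\<beta> \<noteq> {#}"
    then obtain k where "k \<in># \<beta>" by blast
    then show False using empty.prems(1) empty.prems(2)[of k] by auto
  qed
  then show ?case by (auto simp: cycles_on_def)
next
  case (insert b S)
  have fin: "finite (cycles_on S \<pi>)" for \<pi> using insert.hyps(1) by (rule finite_cycles_on)
  have "\<beta> \<noteq> {#}" using insert by auto
  then obtain k where k: "k \<in># \<beta>" by blast
  define \<beta>' where "\<beta>' = \<beta> - {#k#}"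
  have \<beta>: "\<beta> = add_mset k \<beta>'" using k by (simp add: \<beta>'_def)
  have sum: "k + sum_mset \<beta>' = Suc (card S)" using insert by (simp add: \<beta>)
  have part: "j \<ge> 1" if "j \<in># \<beta>'" for j using insert.prems(2)[of j] that by (simp add: \<beta>)
  show ?case
  proof (cases "k = 1")
    case True
    then obtain \<pi> where \<pi>: "\<pi> permutes S" "image_mset card (mset_set (cycles_on S \<pi>)) = \<beta>'"
      using insert.IH[of \<beta>'] sum part by auto
    have "{b} \<notin> cycles_on S \<pi>" using cycles_onD(1)[OF insert.hyps(1) \<pi>(1)] insert.hyps(2) by blast
    then have "image_mset card (mset_set (cycles_on (insert b S) \<pi>)) = \<beta>"
      using \<pi> True fin by (simp add: cycles_on_insert_fixed[OF \<pi>(1) insert.hyps(2)] \<beta>)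
    then show ?thesis using permutes_imp_permutes_insert[OF \<pi>(1)] by blast
  next
    case False
    then have k2: "k \<ge> 2" using insert.prems(2)[OF k] by simp
    have "\<exists>\<pi>. \<pi> permutes S \<and> image_mset card (mset_set (cycles_on S \<pi>)) = add_mset (k - 1) \<beta>'"
      using k2 sum part by (intro insert.IH) auto
    then obtain \<pi> where \<pi>: "\<pi> permutes S" "image_mset card (mset_set (cycles_on S \<pi>))
        = add_mset (k - 1) \<beta>'"
      by blast
    then have "k - 1 \<in># image_mset card (mset_set (cycles_on S \<pi>))" by simp
    then obtain C where C: "C \<in> cycles_on S \<pi>" "card C = k - 1" using fin by auto
    then obtain e where e: "e \<in> S" "C = orbit \<pi> e" by (auto simp: cycles_on_def)
    have bC: "b \<notin> C" "finite C" using cycles_onD(1,2)[OF insert.hyps(1) \<pi>(1) C(1)] insert.hyps(2)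
        by auto
    have new: "insert b C \<notin> cycles_on S \<pi> - {C}"
        using cycles_onD(1)[OF insert.hyps(1) \<pi>(1)] insert.hyps(2) by blast
    have "mset_set (cycles_on S \<pi>) = add_mset C (mset_set (cycles_on S \<pi> - {C}))"
      using C(1) fin by (simp add: mset_set.remove)
    then have "image_mset card (mset_set (cycles_on S \<pi> - {C})) = \<beta>'" using \<pi>(2) C(2) by simp
    then have "image_mset card (mset_set (cycles_on (insert b S) (transpose b e \<circ> \<pi>))) = \<beta>"
      using new bC k2 C(2) fin
      unfolding cycles_on_insert_point[OF insert.hyps(1) \<pi>(1) insert.hyps(2) e(1)] e(2)[symmetric]
          by (simp add: \<beta>)
    moreover have "transpose b e \<circ> \<pi> permutes insert b S"
      using e by (intro permutes_compose permutes_imp_permutes_insert \<pi>(1) permutes_swap_id) auto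
    ultimately show ?thesis by blast
  qed
qed

text \<open>The type has size 2 as a multiset, so there are exactly two cycles, also when m = 2.
  Undoing the swap on a cycle of size 2 leaves c, which fixes its two points and acts as \<alpha> on
  the other cycle.\<close>

lemma two_cycle_type_decomp:
  assumes "finite S" "\<alpha> permutes S" "image_mset card (mset_set (cycles_on S \<alpha>)) = {#2, m#}"
  obtains a b c where "a \<in> S" "b \<in> S" "a \<noteq> b" "c permutes S
      - {a, b}" "cyclic_on c (S - {a, b})" "\<alpha> = c \<circ> transpose a b"
proof -
  let ?Y = "cycles_on S \<alpha>"
  have fin: "finite ?Y" using assms(1) by (rule finite_cycles_on)
  have "2 \<in># image_mset card (mset_set ?Y)" unfolding assms(3) by simp
  then obtain A where A: "A \<in> ?Y" "card A = 2" using fin by auto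
  have "size (image_mset card (mset_set ?Y)) = 2" unfolding assms(3) by simp
  then have "card ?Y = 2" by simp
  then have "card (?Y - {A}) = 1" using A fin by simp
  then obtain B where "?Y - {A} = {B}" by (auto simp: card_1_singleton_iff)
  then have Y: "?Y = {A, B}" "A \<noteq> B" using A by auto
  obtain a b where ab: "A = {a, b}" "a \<noteq> b" using A(2) by (auto simp: card_2_iff)
  have S: "S = A \<union> B" using Union_cycles_on[OF assms(1,2)] Y by auto
  have "A \<inter> B = {}" using cycles_on_disjoint[OF assms(1,2), of A B] Y by auto
  then have B: "B = S - {a, b}" using S ab by auto
  have orb: "orbit \<alpha> a = {a, b}" "orbit \<alpha> b = {a, b}" using cycles_onD(5)[OF assms(1,2) A(1)] ab
      by auto
  have "\<alpha> a \<noteq> a" "\<alpha> b \<noteq> b" using orb ab(2) orbit_eq_singleton_iff[of \<alpha> a]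
      orbit_eq_singleton_iff[of \<alpha> b] by auto
  moreover have "\<alpha> a \<in> {a, b}" "\<alpha> b \<in> {a, b}" using orb orbit.base[of \<alpha>] by metis+
  ultimately have \<alpha>: "\<alpha> a = b" "\<alpha> b = a" by auto
  define c where "c = \<alpha> \<circ> transpose a b"
  have abS: "a \<in> S" "b \<in> S" using S ab by auto
  have "c permutes S" unfolding c_def by (intro permutes_compose assms permutes_swap_id abS)
  then have c: "c permutes S - {a, b}" by (rule permutes_superset) (auto simp: c_def \<alpha>)
  have "B \<in> ?Y" using Y by simp
  then have "cyclic_on \<alpha> B" using cyclic_on_orbit[OF assms(2,1)] by (auto simp: cycles_on_def)
  then have "cyclic_on c (S - {a, b})"
    unfolding B by (subst cyclic_cong[of _ c \<alpha>]) (auto simp: c_def)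
  moreover have "\<alpha> = c \<circ> transpose a b" by (simp add: c_def fun_eq_iff)
  ultimately show ?thesis using that abS ab(2) c by blast
qed

section \<open>From one pair to the sum over all pairs\<close>

lemma exists_permutes_pair:
  assumes "a \<in> S" "b \<in> S" "a \<noteq> b" "a' \<in> S" "b' \<in> S" "a' \<noteq> b'"
  obtains g where "g permutes S" "g a = a'" "g b = b'"
proof -
  let ?t = "transpose a a'"
  have t: "?t permutes S" using assms by (intro permutes_swap_id)
  have tb: "?t b \<in> S" "?t b \<noteq> a'" using assms permutes_in_image[OF t]
      by (auto simp: transpose_eq_iff)
  have "transpose (?t b) b' \<circ> ?t permutes S" using assms tb
      by (intro permutes_compose t permutes_swap_id)
  moreover have "(transpose (?t b) b' \<circ> ?t) a = a'" using tb assms by simp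
  moreover have "(transpose (?t b) b' \<circ> ?t) b = b'" by simp
  ultimately show ?thesis using that by blast
qed

text \<open>Conjugation by a permutation that carries one ordered pair to the other. It allows the
  pair swapped by \<alpha> to be replaced by all pairs.\<close>

lemma sum_deletion_wt_pair_eq:
  assumes "finite S" "conj_invariant S S \<phi>"
    and "a \<in> S" "b \<in> S" "a \<noteq> b" "a' \<in> S" "b' \<in> S" "a' \<noteq> b'"
  shows "(\<Sum>\<omega> | \<omega> permutes S. \<phi> \<omega> * (Z * deletion_wt {a', b'} S (transpose a' b' \<circ> \<omega>)) $ n)
    = (\<Sum>\<omega> | \<omega> permutes S. \<phi> \<omega> * (Z * deletion_wt {a, b} S (transpose a b \<circ> \<omega>)) $ n)"
proof -
  obtain g where g: "g permutes S" "g a = a'" "g b = b'" using exists_permutes_pair[OF assms(3-)] .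
  have "(\<Sum>\<omega> | \<omega> permutes S. \<phi> \<omega> * (Z * deletion_wt {a', b'} S (transpose a' b' \<circ> \<omega>)) $ n)
     = (\<Sum>\<omega> | \<omega> permutes S. \<phi> (g \<circ> \<omega> \<circ> inv g)
         * (Z * deletion_wt {a', b'} S (transpose a' b' \<circ> (g \<circ> \<omega> \<circ> inv g))) $ n)"
    by (rule sum_permutations_conj[OF g(1), symmetric])
  also have "\<dots> = (\<Sum>\<omega> | \<omega> permutes S. \<phi> \<omega> * (Z * deletion_wt {a, b} S (transpose a b \<circ> \<omega>)) $ n)"
  proof (rule sum.cong[OF refl])
    fix \<omega> assume "\<omega> \<in> {\<omega>. \<omega> permutes S}"
    then have \<omega>: "\<omega> permutes S" by simp
    have "transpose a' b' \<circ> (g \<circ> \<omega> \<circ> inv g) = (transpose a' b' \<circ> g) \<circ> \<omega> \<circ> inv g"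
        by (simp only: comp_assoc)
    also have "transpose a' b' \<circ> g = g \<circ> transpose a b"
      using transpose_conj[OF permutes_bij[OF g(1)], of a b] unfolding g(2,3) .
    finally have "transpose a' b' \<circ> (g \<circ> \<omega> \<circ> inv g) = g \<circ> (transpose a b \<circ> \<omega>) \<circ> inv g"
        by (simp only: comp_assoc)
    moreover have "transpose a b \<circ> \<omega> permutes S"
        by (intro permutes_compose \<omega> permutes_swap_id assms)
    moreover have "{a', b'} = g ` {a, b}" using g by simp
    ultimately show "\<phi> (g \<circ> \<omega> \<circ> inv g) * (Z
        * deletion_wt {a', b'} S (transpose a' b' \<circ> (g \<circ> \<omega> \<circ> inv g))) $ n
      = \<phi> \<omega> * (Z * deletion_wt {a, b} S (transpose a b \<circ> \<omega>)) $ n"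
      using deletion_wt_conj[OF assms(1) g(1)] conj_invariantD[OF assms(2) g(1) \<omega>] by metis
  qed
  finally show ?thesis .
qed

text \<open>The transposition is moved from c to the summation variable and both its points are
  deleted; the value is the same for all n (n - 1) ordered pairs, and the sum over them is
  \<open>cut_join 2\<close>. Unlike for long cycles, no sum over a is needed for invariance, since
  the conjugators fix both a and b.\<close>

lemma sum_two_cycle_type:
  assumes "finite S" "card S \<ge> 3" "conj_invariant S S \<phi>"
    and "a \<in> S" "b \<in> S" "a \<noteq> b" "c permutes S - {a, b}" "cyclic_on c (S - {a, b})"
  shows "of_nat (card S * (card S - 1)) *
      (\<Sum>\<omega> | \<omega> permutes S. \<phi> \<omega> * poly_x ^ card (cycles_on S (c \<circ> transpose a b \<circ> \<omega>)))
    = (\<Sum>\<omega> | \<omega> permutes S. \<phi> \<omega> * (binomial_series poly_x * cut_join 2 card (cycles_on S \<omega>)) $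
        (card S - 1))"
    (is "_ * ?L = _")
proof -
  define Z where "Z = binomial_series poly_x"
  define n where "n = card S"
  define f where "f a b \<omega> = \<phi> \<omega> * (Z * deletion_wt {a, b} S (transpose a b \<circ> \<omega>)) $ (n - 1)"
      for a b \<omega>
  have Sab: "S - {a, b} \<union> {a, b} = S" using assms by auto
  \<comment> \<open>The index in the formula for the cycle c, which has n - 2 points.\<close>
  have card: "card (S - {a, b}) + 1 = n - 1" using assms by (simp add: n_def card_Diff_subset)
  then have "card (S - {a, b}) > 0" using assms(2) by (simp add: n_def)
  then have ne: "S - {a, b} \<noteq> {}" by (metis card.empty less_irrefl)
  have "conj_invariant (S - {a, b}) (S - {a, b} \<union> {a, b}) (\<lambda>\<sigma>. \<phi> (transpose a b \<circ> \<sigma>))"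
    unfolding conj_invariant_def Sab
  proof (intro allI impI)
    fix g \<sigma> assume g: "g permutes S - {a, b}" and \<sigma>: "\<sigma> permutes S"
    have gS: "g permutes S" using g by (rule permutes_subset) auto
    have "g a = a" "g b = b" using g by (auto intro: permutes_not_in)
    then have "transpose a b \<circ> (g \<circ> \<sigma> \<circ> inv g) = g \<circ> (transpose a b \<circ> \<sigma>) \<circ> inv g"
      using transpose_conj[OF permutes_bij[OF gS], of a b] by (simp add: comp_assoc[symmetric])
    moreover have "transpose a b \<circ> \<sigma> permutes S"
        by (intro permutes_compose \<sigma> permutes_swap_id assms)
    ultimately show "\<phi> (transpose a b \<circ> (g \<circ> \<sigma> \<circ> inv g)) = \<phi> (transpose a b \<circ> \<sigma>)"
      using conj_invariantD[OF assms(3) gS] by metis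
  qed
  note del = long_cycle_sum_with_deletions[OF _ _ _ long_cycle_formula[OF _ ne] assms(7,8) this,
      unfolded Sab card]
  have cancel: "c \<circ> transpose a b \<circ> (transpose a b \<circ> \<sigma>)
      = c \<circ> \<sigma>" "transpose a b \<circ> (transpose a b \<circ> \<sigma>) = \<sigma>"
    for \<sigma> :: "'a \<Rightarrow> 'a" by (simp_all add: fun_eq_iff)
  have "?L = (\<Sum>\<sigma> | \<sigma> permutes S. \<phi> (transpose a b \<circ> \<sigma>) * poly_x ^ card (cycles_on S (c \<circ> \<sigma>)))"
    by (subst setum_permutations_compose_left[OF permutes_swap_id[OF assms(4,5)]])
        (simp only: cancel)
  also have "\<dots> = (\<Sum>\<sigma> | \<sigma> permutes S. \<phi> (transpose a b \<circ> \<sigma>)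
      * (Z * deletion_wt {a, b} S \<sigma>) $ (n - 1))"
    unfolding Z_def by (rule del) (use assms(1) in auto)
  also have "\<dots> = (\<Sum>\<omega> | \<omega> permutes S. f a b \<omega>)"
    unfolding f_def by (subst setum_permutations_compose_left[OF permutes_swap_id[OF assms(4,5)]])
        (simp only: cancel)
  finally have L: "?L = (\<Sum>\<omega> | \<omega> permutes S. f a' b' \<omega>)" if "b' \<in> S" "a' \<in> S - {b'}" for a' b'
    using sum_deletion_wt_pair_eq[OF assms(1,3-6), of a' b'] that unfolding f_def by auto
  have "of_nat (card S * (card S - 1)) * ?L = (\<Sum>b'\<in>S. \<Sum>a'\<in>S-{b'}. ?L)"
    using assms(1) by (simp add: mult.assoc)
  also have "\<dots> = (\<Sum>b'\<in>S. \<Sum>a'\<in>S-{b'}. \<Sum>\<omega> | \<omega> permutes S. f a' b' \<omega>)"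
    by (intro sum.cong refl L)
  also have "\<dots> = (\<Sum>b'\<in>S. \<Sum>\<omega> | \<omega> permutes S. \<Sum>a'\<in>S-{b'}. f a' b' \<omega>)"
    by (intro sum.cong refl sum.swap)
  also have "\<dots> = (\<Sum>\<omega> | \<omega> permutes S. \<Sum>b'\<in>S. \<Sum>a'\<in>S-{b'}. f a' b' \<omega>)"
    by (rule sum.swap)
  also have "\<dots> = (\<Sum>\<omega> | \<omega> permutes S. \<phi> \<omega> * (Z * cut_join 2 card (cycles_on S \<omega>)) $ (n - 1))"
  proof (rule sum.cong[OF refl])
    fix \<omega> assume "\<omega> \<in> {\<omega>. \<omega> permutes S}"
    then have \<omega>: "\<omega> permutes S" by simp
    have "(\<Sum>b'\<in>S. \<Sum>a'\<in>S-{b'}. deletion_wt {a', b'} S (transpose a' b' \<circ> \<omega>))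
        = cut_join 2 card (cycles_on S \<omega>)"
      by (rule sum_deletion_wt[OF assms(1) \<omega>]) auto
    moreover have "(\<Sum>b'\<in>S. \<Sum>a'\<in>S-{b'}. f a' b' \<omega>)
      = \<phi> \<omega> * (Z * (\<Sum>b'\<in>S. \<Sum>a'\<in>S-{b'}. deletion_wt {a', b'} S (transpose a' b' \<circ> \<omega>))) $ (n - 1)"
      unfolding f_def by (simp add: sum_distrib_left fps_sum_nth)
    ultimately show "(\<Sum>b'\<in>S. \<Sum>a'\<in>S-{b'}. f a' b' \<omega>)
        = \<phi> \<omega> * (Z * cut_join 2 card (cycles_on S \<omega>)) $ (n - 1)"
      by (simp only:)
  qed
  finally show ?thesis unfolding Z_def n_def .
qed

theorem theorem3p11:
  fixes n :: nat and \<beta> :: "nat multiset" and \<alpha> :: "nat \<Rightarrow> nat"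
  assumes "is_partition \<beta> n"
    and "size \<beta> \<ge> 1"
    and "\<forall>b \<in># \<beta>. b \<ge> 3"
    and "\<alpha> \<in> perms_of_type n {#2, n - 2#}"
  shows "P_poly n \<alpha> \<beta> =
    fps_nth
      (fps_const poly_x * fps_X ^ 2 * binomial_series (poly_x - 2)
        * (2 * fps_const poly_x + fps_const poly_x * fps_X + fps_X)
        * (\<Prod>b \<in># \<beta>. (1 + fps_X) ^ b - 1)) n"
    (is "_ = ?R")
proof -
  define S where "S = {1..n}"
  have S: "finite S" "card S = n" by (simp_all add: S_def)
  have type: "cycle_type n \<pi> = image_mset card (mset_set (cycles_on S \<pi>))"
    and num: "num_cycles n \<pi> = card (cycles_on S \<pi>)" for \<pi>
    by (simp_all add: cycle_type_def num_cycles_def cycle_sets_def cycles_on_def S_def)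
  have C: "perms_of_type n \<gamma> = {\<pi> \<in> {\<pi>. \<pi> permutes S}. cycle_type n \<pi> = \<gamma>}" for \<gamma>
    by (auto simp: perms_of_type_def S_def)
  have finC: "finite (perms_of_type n \<beta>)" unfolding C by (simp add: finite_permutations S)
  have sum\<beta>: "sum_mset \<beta> = card S" using assms(1) by (simp add: is_partition_def S)
  have "k \<ge> 1" if "k \<in># \<beta>" for k using assms(1) that by (simp add: is_partition_def)
  then obtain \<pi>\<^sub>0 where "\<pi>\<^sub>0 permutes S" "image_mset card (mset_set (cycles_on S \<pi>\<^sub>0)) = \<beta>"
    using exists_permutation_of_type[OF S(1) sum\<beta>] by blast
  then have "\<pi>\<^sub>0 \<in> perms_of_type n \<beta>" by (simp add: C type)
  then have card0: "card (perms_of_type n \<beta>) \<noteq> 0" using finC by auto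
  have "\<beta> \<noteq> {#}" using assms(2) by auto
  then obtain k where k: "k \<in># \<beta>" by blast
  have "sum_mset \<beta> = k + sum_mset (\<beta> - {#k#})" using sum_mset.remove[OF k] .
  moreover have "k \<ge> 3" using assms(3) k by blast
  ultimately have n3: "card S \<ge> 3" using sum\<beta> by simp
  obtain a b c where abc: "a \<in> S" "b \<in> S" "a \<noteq> b" "c permutes S - {a, b}" "cyclic_on c (S - {a, b})"
    and \<alpha>: "\<alpha> = c \<circ> transpose a b"
    using two_cycle_type_decomp[OF S(1), of \<alpha> "n - 2"] assms(4) unfolding C type by auto
  \<comment> \<open>The indicator of the class turns the identity for class functions into one for
    the permutations of type \<beta>.\<close>
  define \<phi> :: "(nat \<Rightarrow> nat) \<Rightarrow> rat poly" where "\<phi> \<omega> = (if cycle_type n \<omega> = \<beta> then 1 else 0)" for \<omega>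
  have "conj_invariant S S \<phi>"
    unfolding conj_invariant_def \<phi>_def type using cycle_type_conj[OF S(1)] by simp
  note main = sum_two_cycle_type[OF S(1) n3 this abc, folded \<alpha>]
  have restrict: "(\<Sum>\<omega> | \<omega> permutes S. \<phi> \<omega> * f \<omega>) = (\<Sum>\<omega>\<in>perms_of_type n \<beta>. f \<omega>)" for f
    unfolding \<phi>_def C using finite_permutations[OF S(1)]
    by (subst sum.inter_filter) (auto intro!: sum.cong)
  \<comment> \<open>On the class the coefficient depends on \<beta> alone, so the right side becomes
    the class size times one coefficient.\<close>
  have R: "(binomial_series poly_x * cut_join 2 card (cycles_on S \<omega>)) $ (card S - 1) = ?R"
      if "\<omega> \<in> perms_of_type n \<beta>" for \<omega>
  proof -
    have \<omega>: "\<omega> permutes S" "image_mset card (mset_set (cycles_on S \<omega>)) = \<beta>" using that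
        by (auto simp: C type)
    have fin: "finite (cycles_on S \<omega>)" using S(1) by (rule finite_cycles_on)
    have "cycle_prod card (cycles_on S \<omega>) = (\<Prod>b\<in>#\<beta>. (1 + fps_X) ^ b - 1)"
      unfolding \<omega>(2)[symmetric] cycle_prod_def
          by (simp add: prod_unfold_prod_mset image_mset.compositionality comp_def)
    moreover have "cycles_on S \<omega> \<noteq> {}" using \<open>\<beta> \<noteq> {#}\<close> \<omega>(2) by auto
    moreover have "card C \<ge> 3" if "C \<in> cycles_on S \<omega>" for C
    proof -
      have "card C \<in># \<beta>" unfolding \<omega>(2)[symmetric] using that fin by simp
      then show ?thesis using assms(3) by blast
    qed
    ultimately show ?thesis
      using cut_join_2_coeff[OF fin, of card] by (simp add: sum_card_cycles[OF S(1) \<omega>(1)] S(2))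
  qed
  have "of_nat (n * (n - 1)) * (\<Sum>\<omega>\<in>perms_of_type n \<beta>. poly_x ^ num_cycles n (\<alpha> \<circ> \<omega>))
     = (\<Sum>\<omega>\<in>perms_of_type n \<beta>. ?R)"
    using main R unfolding restrict S(2) num by simp
  also have "\<dots> = of_nat (card (perms_of_type n \<beta>)) * ?R" by simp
  finally have "smult (of_nat (n * (n - 1))) (\<Sum>\<omega>\<in>perms_of_type n \<beta>. poly_x ^ num_cycles n (\<alpha> \<circ> \<omega>))
     = smult (of_nat (card (perms_of_type n \<beta>))) ?R"
    by (simp only: of_nat_mult_conv_smult)
  then have "smult (1 / of_nat (card (perms_of_type n \<beta>)))
      (smult (of_nat (n * (n - 1))) (\<Sum>\<omega>\<in>perms_of_type n \<beta>. poly_x ^ num_cycles n (\<alpha> \<circ> \<omega>))) = ?R"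
    using card0 by simp
  then show ?thesis unfolding P_poly_def by simp
qed

end
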